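(* Let $w\in\mathfrak{S}_n$ and $\pi\in\mathrm{NC}(n)$ be such that $w(\pi)\in\mathrm{NC}(n)$. Then, with respect to the skein action of $\mathfrak{S}_n$ on $\mathbb{C}[\mathrm{NC}(n)]$, $$w\cdot\pi=\mathrm{sign}(w)\cdot w(\pi).$$
   Context: $\Pi(n)$ is the set of all set partitions of $[n]$; $\mathrm{NC}(n)$ is the set of noncrossing ones (whenever $a<b<c<d$ with $a,c$ in the same block and $b,d$ in the same block, all four are in the same block). $\mathbb{C}[\mathrm{NC}(n)]$ is the vector space with basis $\mathrm{NC}(n)$. For $w\in\mathfrak{S}_n$ and $\pi \in \Pi(n)$, $w(\pi)$ is the set partition with blocks $w(B)$, $B$ a block of $\pi$; $s_i=(i,i+1)$. Skein action. For $\mu\in\Pi(n)$ not noncrossing with $s_i(\mu)$ noncrossing, the indices $i,i+1$ lie in different blocks $B_i\ni i$, $B_{i+1}\ni i+1$ of $\mu$, both of size at least 2. Let $\mu_1,\dots,\mu_4$ be obtained from $\mu$ by replacing the pair $B_i,B_{i+1}$ by the pair: $(B_i-\{i\})\cup\{i+1\}$ and $(B_{i+1}-\{i+1\})\cup\{i\}$ for $\mu_1$; $(B_i\cup B_{i+1})-\{i,i+1\}$ and $\{i,i+1\}$ for $\mu_2$; $B_i-\{i\}$ and $B_{i+1}\cup\{i\}$ for $\mu_3$; $B_{i+1}-\{i+1\}$ and $B_i\cup\{i+1\}$ for $\mu_4$. Set $\sigma(\mu)=\mu_1+\mu_2$ if $|B_i|=|B_{i+1}|=2$; $\mu_1+\mu_2-\mu_3$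 if $|B_i|>2,|B_{i+1}|=2$; $\mu_1+\mu_2-\mu_4$ if $|B_i|=2,|B_{i+1}|>2$; $\mu_1+\mu_2-\mu_3-\mu_4$ if $|B_i|,|B_{i+1}|>2$; this lies in $\mathbb{C}[\mathrm{NC}(n)]$. The skein action is given on generators by $s_i\cdot\pi=-s_i(\pi)$ if $s_i(\pi)$ is noncrossing and $s_i\cdot\pi=\sigma(s_i(\pi))$ otherwise ($\pi\in\mathrm{NC}(n)$). These operators satisfy the Coxeter relations, so they define an action of $\mathfrak{S}_n$ on $\mathbb{C}[\mathrm{NC}(n)]$. *)

theory Defs
  imports Complex_Main "HOL-Library.Disjoint_Sets" "HOL-Library.Poly_Mapping"
    "HOL-Combinatorics.Permutations"
begin

type_synonym set_partition = "nat set set"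

definition set_partitions :: "nat \<Rightarrow> set_partition set" where
  "set_partitions n = {\<pi>. partition_on {1..n} \<pi>}"

definition noncrossing :: "set_partition \<Rightarrow> bool" where
  "noncrossing \<pi> \<longleftrightarrow>
     (\<forall>a b c d. a < b \<and> b < c \<and> c < d
        \<and> (\<exists>B\<in>\<pi>. a \<in> B \<and> c \<in> B) \<and> (\<exists>C\<in>\<pi>. b \<in> C \<and> d \<in> C)
        \<longrightarrow> (\<exists>D\<in>\<pi>. a \<in> D \<and> b \<in> D \<and> c \<in> D \<and> d \<in> D))"

definition NC :: "nat \<Rightarrow> set_partition set" where
  "NC n = {\<pi> \<in> set_partitions n. noncrossing \<pi>}"

definition perm_image :: "(nat \<Rightarrow> nat) \<Rightarrow> set_partition \<Rightarrow> set_partition" where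
  "perm_image w \<pi> = (\<lambda>B. w ` B) ` \<pi>"

abbreviation adj_transp :: "nat \<Rightarrow> nat \<Rightarrow> nat" where
  "adj_transp i \<equiv> transpose i (i + 1)"

text \<open>
  The space of formal complex linear combinations of noncrossing partitions of
  \<open>{1..n}\<close> is represented inside \<open>set_partition \<Rightarrow>\<^sub>0 complex\<close>, as the subspace of the
  combinations whose support is contained in \<open>NC n\<close>.
\<close>

type_synonym skein_vec = "set_partition \<Rightarrow>\<^sub>0 complex"

abbreviation basis_vec :: "set_partition \<Rightarrow> skein_vec" where
  "basis_vec \<pi> \<equiv> Poly_Mapping.single \<pi> 1"

abbreviation scale_vec :: "complex \<Rightarrow> skein_vec \<Rightarrow> skein_vec" where
  "scale_vec c \<equiv> Poly_Mapping.map ((*) c)"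

definition linear_extension :: "(set_partition \<Rightarrow> skein_vec) \<Rightarrow> skein_vec \<Rightarrow> skein_vec" where
  "linear_extension f v =
     (\<Sum>\<pi>\<in>Poly_Mapping.keys v. scale_vec (Poly_Mapping.lookup v \<pi>) (f \<pi>))"

definition block_of :: "set_partition \<Rightarrow> nat \<Rightarrow> nat set" where
  "block_of \<mu> i = (THE B. B \<in> \<mu> \<and> i \<in> B)"

definition replace_blocks ::
    "nat \<Rightarrow> set_partition \<Rightarrow> nat set \<Rightarrow> nat set \<Rightarrow> set_partition" where
  "replace_blocks i \<mu> X Y = (\<mu> - {block_of \<mu> i, block_of \<mu> (i + 1)}) \<union> {X, Y}"

text \<open>
  The resolution of the crossing of \<open>\<mu>\<close> at \<open>i, i + 1\<close>. It is meant for \<open>\<mu>\<close> not noncrossing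
  with \<open>s\<^sub>i(\<mu>)\<close> noncrossing; the blocks of \<open>i\<close> and \<open>i + 1\<close> are then distinct and have at
  least two elements, so that the two conditionals produce exactly the four cases
  (each of the two sizes being either equal to or greater than 2).
\<close>

definition skein_resolution :: "nat \<Rightarrow> set_partition \<Rightarrow> skein_vec" where
  "skein_resolution i \<mu> =
     (let B = block_of \<mu> i; C = block_of \<mu> (i + 1);
          \<mu>1 = replace_blocks i \<mu> ((B - {i}) \<union> {i + 1}) ((C - {i + 1}) \<union> {i});
          \<mu>2 = replace_blocks i \<mu> ((B \<union> C) - {i, i + 1}) {i, i + 1};
          \<mu>3 = replace_blocks i \<mu> (B - {i}) (C \<union> {i});
          \<mu>4 = replace_blocks i \<mu> (C - {i + 1}) (B \<union> {i + 1})
      in basis_vec \<mu>1 + basis_vec \<mu>2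
           - (if card B > 2 then basis_vec \<mu>3 else 0)
           - (if card C > 2 then basis_vec \<mu>4 else 0))"

definition skein_gen_basis :: "nat \<Rightarrow> set_partition \<Rightarrow> skein_vec" where
  "skein_gen_basis i \<pi> =
     (let \<mu> = perm_image (adj_transp i) \<pi>
      in if noncrossing \<mu> then - basis_vec \<mu> else skein_resolution i \<mu>)"

definition skein_gen :: "nat \<Rightarrow> skein_vec \<Rightarrow> skein_vec" where
  "skein_gen i = linear_extension (skein_gen_basis i)"

definition adj_word :: "nat \<Rightarrow> nat list \<Rightarrow> (nat \<Rightarrow> nat) \<Rightarrow> bool" where
  "adj_word n is w \<longleftrightarrow> set is \<subseteq> {1..<n} \<and> foldr (\<lambda>i u. adj_transp i \<circ> u) is id = w"

text \<open>
  \<open>skein_act n w v\<close> is the common value of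
  \<open>s\<^sub>i\<^sub>1 \<cdot> (s\<^sub>i\<^sub>2 \<cdot> (\<dots> (s\<^sub>i\<^sub>k \<cdot> v)))\<close> over all expressions \<open>w = s\<^sub>i\<^sub>1 \<circ> s\<^sub>i\<^sub>2 \<circ> \<dots> \<circ> s\<^sub>i\<^sub>k\<close>, for
  \<open>w\<close> a permutation of \<open>{1..n}\<close> and \<open>v\<close> supported on \<open>NC n\<close>. That this value does not depend
  on the expression is the content of the Coxeter relations for the operators \<open>skein_gen i\<close>;
  it is not built into the definition.
\<close>

definition skein_act :: "nat \<Rightarrow> (nat \<Rightarrow> nat) \<Rightarrow> skein_vec \<Rightarrow> skein_vec" where
  "skein_act n w v = (THE u. \<forall>is. adj_word n is w \<longrightarrow> foldr skein_gen is v = u)"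

end

theory Submission
  imports Defs
begin

text \<open>
  The skein module is realised inside tuples of numbers on which permutations visibly act.
  Fix two disjoint lists \<open>xs\<close>, \<open>ys\<close> of the same length \<open>k\<close>. To a set partition with
  non-singleton blocks \<open>B\<^sub>1, \<dots>, B\<^sub>k\<close> and a prescribed set of singletons
  assign the product of the two \<open>0/1\<close> determinants with entries \<open>[x\<^sub>a \<in> B\<^sub>b]\<close> and \<open>[y\<^sub>a \<in> B\<^sub>b]\<close>;
  this does not depend on the order of the blocks. (It is a coefficient
  of the product of the elements \<open>\<Sum>\<^bsub>p, q \<in> B\<^esub> u\<^sub>p v\<^sub>q\<close>, \<open>p \<noteq> q\<close>, over all blocks \<open>B\<close>, where the
  \<open>u\<^sub>p\<close>, \<open>v\<^sub>q\<close> anticommute.) Bilinearity and antisymmetry of the determinants in two columns yield the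
  five-term skein relation, so each generator acts on these numbers as minus the relabelling by
  \<open>s\<^sub>i\<close>, and every word for \<open>w\<close> acts as \<open>sign w\<close> times the relabelling by \<open>w\<close>. Taking block minima
  for \<open>xs\<close> and block maxima for \<open>ys\<close> shows, by triangularity, that the numbers separate the vectors
  supported on noncrossing partitions. Hence all words for \<open>w\<close> send \<open>\<pi>\<close> to the same vector
  \<open>sign w \<cdot> w(\<pi>)\<close>.
\<close>

section \<open>Determinants of incidences with blocks\<close>

definition block_det :: "nat list \<Rightarrow> nat set list \<Rightarrow> complex" where
  "block_det xs bs = (\<Sum>p | p permutes {..<length bs}.
     of_int (sign p) * (\<Prod>a<length bs. of_bool (xs ! a \<in> bs ! p a)))"

text \<open>Reindexing the sum along \<open>p \<mapsto> q \<circ> p\<close> and multiplicativity of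
  the sign give the alternating property in the columns.\<close>

lemma block_det_permute:
  assumes q: "q permutes {..<length bs}"
  shows "block_det xs (permute_list q bs) = of_int (sign q) * block_det xs bs"
proof -
  let ?K = "{..<length bs}"
  let ?f = "\<lambda>p. of_int (sign p) * (\<Prod>a<length bs. of_bool (xs ! a \<in> bs ! p a)) :: complex"
  have "of_int (sign q) * block_det xs bs
      = (\<Sum>p | p permutes ?K. of_int (sign q) * ?f p)"
    by (simp add: block_det_def sum_distrib_left)
  also have "\<dots> = (\<Sum>p | p permutes ?K. of_int (sign q) * ?f (q \<circ> p))"
    by (rule sum.reindex_bij_betw[symmetric])
      (rule bij_betwI[where g = "\<lambda>p. inv q \<circ> p"],
       use q in \<open>auto simp: permutes_compose permutes_inv o_assoc permutes_inv_o\<close>)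
  also have "\<dots> = (\<Sum>p | p permutes ?K. of_int (sign p) *
      (\<Prod>a<length bs. of_bool (xs ! a \<in> permute_list q bs ! p a)))"
  proof (rule sum.cong[OF refl], clarify)
    fix p assume p: "p permutes ?K"
    have "sign (q \<circ> p) = sign q * sign p"
      by (meson finite_lessThan p permutes_imp_permutation q sign_compose)
    moreover have "permute_list q bs ! p a = bs ! q (p a)" if "a < length bs" for a
      using that p q by (metis lessThan_iff permute_list_nth permutes_in_image)
    ultimately show "of_int (sign q) * ?f (q \<circ> p) = of_int (sign p) *
      (\<Prod>a<length bs. of_bool (xs ! a \<in> permute_list q bs ! p a))"
      by (simp add: mult.assoc[symmetric] flip: of_int_mult)
  qed
  finally show ?thesis
    by (simp add: block_det_def)
qed

lemma block_det_swap: "block_det xs (P # Q # bs) = - block_det xs (Q # P # bs)"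
proof -
  let ?t = "Transposition.transpose 0 (Suc 0)"
  have t: "?t permutes {..<length (Q # P # bs)}"
    by (rule permutes_swap_id) auto
  have "permute_list ?t (Q # P # bs) = P # Q # bs"
  proof (rule nth_equalityI)
    fix i assume "i < length (permute_list ?t (Q # P # bs))"
    then show "permute_list ?t (Q # P # bs) ! i = (P # Q # bs) ! i"
      using permute_list_nth[OF t, of i]
      by (cases i; cases "i - 1") (auto simp: transpose_def)
  qed simp
  then show ?thesis
    using block_det_permute[OF t, of xs] by (simp add: sign_swap_id)
qed

lemma block_det_repeat: "block_det xs (P # P # bs) = 0"
  using block_det_swap[of xs P P bs] by simp

text \<open>A permutation uses column 0 exactly once, in row \<open>inv p 0\<close>. Isolating that
  factor allows linearity in the first column to be checked term by term.\<close>

lemma prod_permuted_column: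
  assumes p: "p permutes {..<Suc k}"
  shows "(\<Prod>a<Suc k. f a (p a)) =
    f (inv p 0) 0 * (\<Prod>a\<in>{..<Suc k} - {inv p 0}. f a (p a) :: complex)"
proof -
  have "inv p 0 \<in> {..<Suc k}"
    using p by (metis lessThan_iff permutes_in_image permutes_inv zero_less_Suc)
  then show ?thesis
    using p prod.remove[of "{..<Suc k}" "inv p 0" "\<lambda>a. f a (p a)"]
    by (simp add: permutes_inverses del: prod.lessThan_Suc)
qed

text \<open>Disjointness turns membership in \<open>P \<union> Q\<close> into the sum of two
  indicators, and each product contains exactly one factor from the first column.\<close>

lemma block_det_union:
  assumes "P \<inter> Q = {}"
  shows "block_det xs ((P \<union> Q) # bs) = block_det xs (P # bs) + block_det xs (Q # bs)"
proof -
  have *: "(\<Prod>a<Suc (length bs). of_bool (xs ! a \<in> ((P \<union> Q) # bs) ! p a)) =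
      (\<Prod>a<Suc (length bs). of_bool (xs ! a \<in> (P # bs) ! p a)) +
      (\<Prod>a<Suc (length bs). of_bool (xs ! a \<in> (Q # bs) ! p a) :: complex)"
    if p: "p permutes {..<Suc (length bs)}" for p
  proof -
    let ?R = "{..<Suc (length bs)} - {inv p 0}"
    \<comment> \<open>Outside row \<open>inv p 0\<close> the first block is never consulted, so
      these factors are common to all three determinants.\<close>
    have col: "(\<Prod>a\<in>?R. of_bool (xs ! a \<in> (X # bs) ! p a) :: complex)
        = (\<Prod>a\<in>?R. of_bool (xs ! a \<in> bs ! (p a - 1)))" for X
    proof (rule prod.cong[OF refl])
      fix a assume "a \<in> ?R"
      then have "p a \<noteq> 0"
        using permutes_inverses(2)[OF p, of a] by (intro notI) simp
      then show "of_bool (xs ! a \<in> (X # bs) ! p a) = (of_bool (xs ! a \<in> bs ! (p a - 1)) :: complex)"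
        by (cases "p a") auto
    qed
    show ?thesis
      using assms unfolding prod_permuted_column[OF p, of "\<lambda>a b. of_bool (xs ! a \<in> (_ # bs) ! b)"] col
      by (auto simp: of_bool_def)
  qed
  show ?thesis
    unfolding block_det_def by (simp add: * distrib_left sum.distrib del: prod.lessThan_Suc)
qed

text \<open>Some term of the expansion is nonzero; its permutation matches every listed point with a
  block containing it.\<close>

lemma block_det_nonzeroD:
  assumes "block_det xs bs \<noteq> 0"
  obtains p where "p permutes {..<length bs}" "\<And>a. a < length bs \<Longrightarrow> xs ! a \<in> bs ! p a"
proof -
  obtain p where p: "p permutes {..<length bs}"
    and "(\<Prod>a<length bs. of_bool (xs ! a \<in> bs ! p a)) \<noteq> (0 :: complex)"
    using assms unfolding block_det_def by (metis (no_types, lifting) mem_Collect_eq mult_eq_0_iff sum.neutral)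
  then have "xs ! a \<in> bs ! p a" if "a < length bs" for a
    using that by (auto simp: prod_zero_iff)
  with p show thesis by (rule that)
qed

text \<open>The block \<open>B\<close> contributes a zero column: a matching would have to place
  some entry of \<open>xs\<close> in it.\<close>

lemma block_det_disjoint_block:
  assumes "length xs = length bs" "B \<in> set bs" "set xs \<inter> B = {}"
  shows "block_det xs bs = 0"
proof (rule ccontr)
  assume "block_det xs bs \<noteq> 0"
  then obtain p where p: "p permutes {..<length bs}" "\<And>a. a < length bs \<Longrightarrow> xs ! a \<in> bs ! p a"
    by (rule block_det_nonzeroD) blast
  obtain b where b: "b < length bs" "bs ! b = B"
    using assms(2) by (metis in_set_conv_nth)
  have "inv p b < length bs"
    using b p(1) by (metis lessThan_iff permutes_in_image permutes_inv)
  then have "xs ! inv p b \<in> B" "xs ! inv p b \<in> set xs"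
    using p b assms(1) by (metis permutes_inverses(1), simp)
  then show False using assms(3) by blast
qed

text \<open>By disjointness a representative lies in no other block, so the incidence matrix is the
  identity.\<close>

lemma block_det_representatives:
  assumes len: "length xs = length bs" and dist: "distinct bs" and disj: "disjoint (set bs)"
    and rep: "\<And>a. a < length bs \<Longrightarrow> xs ! a \<in> bs ! a"
  shows "block_det xs bs = 1"
proof -
  have "(\<Prod>a<length bs. of_bool (xs ! a \<in> bs ! p a)) = (of_bool (p = id) :: complex)"
    if p: "p permutes {..<length bs}" for p
  proof (cases "p = id")
    case True
    then show ?thesis using rep by simp
  next
    case False
    then obtain a where a: "p a \<noteq> a" by (auto simp: fun_eq_iff)
    then have "a < length bs" "p a < length bs"
      using p by (metis lessThan_iff permutes_not_in, metis lessThan_iff permutes_in_image permutes_not_in)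
    then have "xs ! a \<notin> bs ! p a"
      using rep[of a] a dist disj by (metis disjoint_iff disjointD nth_eq_iff_index_eq nth_mem)
    then show ?thesis
      using \<open>a < length bs\<close> False by (auto intro!: prod_zero)
  qed
  then have "block_det xs bs = (\<Sum>p | p permutes {..<length bs}. of_int (sign p) * of_bool (p = id))"
    unfolding block_det_def by (intro sum.cong) auto
  also have "\<dots> = (\<Sum>p\<in>{id :: nat \<Rightarrow> nat}. of_int (sign p) * of_bool (p = id))"
    by (rule sum.mono_neutral_right) (auto simp: finite_permutations permutes_id)
  finally show ?thesis by (simp add: sign_id)
qed

lemma block_det_map_image:
  assumes "inj w" "length xs = length bs"
  shows "block_det (map w xs) (map ((`) w) bs) = block_det xs bs"
  unfolding block_det_def
proof (simp, rule sum.cong[OF refl], clarify)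
  fix p assume "p permutes {..<length bs}"
  then have "p a < length bs" if "a < length bs" for a
    using that by (metis lessThan_iff permutes_in_image)
  then show "of_int (sign p) * (\<Prod>a<length bs. of_bool (map w xs ! a \<in> map ((`) w) bs ! p a)) =
    (of_int (sign p) * (\<Prod>a<length bs. of_bool (xs ! a \<in> bs ! p a)) :: complex)"
    using assms by (auto simp: inj_image_mem_iff)
qed

text \<open>\<open>block_det\<close> reads a list only at positions below \<open>length bs\<close>,
  so the lengths are checked here. The default 0 makes a nonzero value reveal the number of
  blocks.\<close>

definition web_coeff :: "nat list \<Rightarrow> nat list \<Rightarrow> nat set list \<Rightarrow> complex" where
  "web_coeff xs ys bs = (if length xs = length bs \<and> length ys = length bs
     then block_det xs bs * block_det ys bs else 0)"

text \<open>A reordering multiplies both determinants by the same sign, which squares to 1.\<close>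

lemma web_coeff_mset:
  assumes "mset bs = mset cs"
  shows "web_coeff xs ys bs = web_coeff xs ys cs"
proof -
  obtain q where q: "q permutes {..<length cs}" "permute_list q cs = bs"
    using mset_eq_permutation[OF assms] by blast
  have "(of_int (sign q) * of_int (sign q) :: complex) = 1"
    by (simp flip: of_int_mult)
  then have "block_det xs bs * block_det ys bs = block_det xs cs * block_det ys cs"
    unfolding q(2)[symmetric] block_det_permute[OF q(1)] by (simp add: algebra_simps)
  then show ?thesis
    using mset_eq_length[OF assms] by (simp add: web_coeff_def)
qed

text \<open>
  After expanding the blocks \<open>A\<close>, \<open>C\<close>, \<open>{i}\<close>, \<open>{j}\<close> columnwise, a term using the column \<open>{i}\<close> in both
  determinants vanishes because \<open>i\<close> does not occur in both lists; the rest cancels by antisymmetry.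
\<close>

lemma web_coeff_five_term:
  assumes xy: "set xs \<inter> set ys = {}"
    and disj: "A \<inter> C = {}" "i \<notin> A" "i \<notin> C" "j \<notin> A" "j \<notin> C" "i \<noteq> j"
  shows "web_coeff xs ys ((A \<union> {i}) # (C \<union> {j}) # bs) + web_coeff xs ys ((A \<union> {j}) # (C \<union> {i}) # bs)
       + web_coeff xs ys ((A \<union> C) # ({i} \<union> {j}) # bs)
       - web_coeff xs ys (A # ((C \<union> {i}) \<union> {j}) # bs) - web_coeff xs ys (C # ((A \<union> {i}) \<union> {j}) # bs) = 0"
proof (cases "length xs = Suc (Suc (length bs)) \<and> length ys = Suc (Suc (length bs))")
  case True
  note U1 = block_det_union[of _ _ _ "_ # bs"]
  have U2: "block_det zs (X # (P \<union> Q) # bs) = block_det zs (X # P # bs) + block_det zs (X # Q # bs)"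
    if "P \<inter> Q = {}" for zs X P Q
    using block_det_union[OF that, of zs "X # bs"] by (simp add: block_det_swap[of zs X])
  have Z1: "block_det zs ({k} # X # bs) = 0 \<and> block_det zs (X # {k} # bs) = 0"
    if "k \<notin> set zs" "length zs = Suc (Suc (length bs))" for zs k X
    using that by (auto intro!: block_det_disjoint_block[where B = "{k}"])
  have D: "A \<inter> {i} = {}" "A \<inter> {j} = {}" "C \<inter> {i} = {}" "C \<inter> {j} = {}" "{i} \<inter> {j} = {}"
    "(C \<union> {i}) \<inter> {j} = {}" "(A \<union> {i}) \<inter> {j} = {}" 
    using disj by auto
  \<comment> \<open>These swaps bring all columns into the fixed order \<open>A\<close>,
    \<open>C\<close>, \<open>{i}\<close>, \<open>{j}\<close>, so that equal determinants become
    syntactically equal.\<close>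
  note S = block_det_swap[of _ C A] block_det_swap[of _ "{i}" A] block_det_swap[of _ "{j}" A]
    block_det_swap[of _ "{i}" C] block_det_swap[of _ "{j}" C] block_det_swap[of _ "{j}" "{i}"]
  have *: "i \<notin> set xs \<or> i \<notin> set ys" "j \<notin> set xs \<or> j \<notin> set ys"
    using xy by auto
  show ?thesis
    using True *(1) *(2)
    unfolding web_coeff_def
    apply (simp only: U1 U2 D disj S block_det_repeat list.size simp_thms if_True)
    apply (elim disjE)
       apply (simp_all add: Z1 algebra_simps)
    done
qed (auto simp: web_coeff_def)

text \<open>The point \<open>k\<close> is missing from one of the lists, where \<open>{k}\<close>
  gives a zero column. This disposes of the terms that the skein resolution omits for blocks of size
  2.\<close>

lemma web_coeff_singleton:
  assumes "set xs \<inter> set ys = {}"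
  shows "web_coeff xs ys ({k} # bs) = 0"
  using assms block_det_disjoint_block[of xs "{k} # bs" "{k}"]
    block_det_disjoint_block[of ys "{k} # bs" "{k}"]
  by (auto simp: web_coeff_def)

text \<open>Singleton blocks would make the web coefficient vanish, so they are recorded separately
  by matching them exactly with \<open>S\<close>. The chosen enumeration of the other blocks is
  immaterial by \<open>web_coeff_mset\<close>.\<close>

definition partition_coeff ::
    "set_partition \<Rightarrow> nat list \<Rightarrow> nat list \<Rightarrow> set_partition \<Rightarrow> complex" where
  "partition_coeff S xs ys \<pi> = (if {B \<in> \<pi>. card B = 1} = S
     then web_coeff xs ys (SOME bs. distinct bs \<and> set bs = {B \<in> \<pi>. card B \<noteq> 1}) else 0)"

lemma partition_coeff_eq:
  assumes "distinct bs" "set bs = {B \<in> \<pi>. card B \<noteq> 1}"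
  shows "partition_coeff S xs ys \<pi> =
    (if {B \<in> \<pi>. card B = 1} = S then web_coeff xs ys bs else 0)"
proof -
  let ?cs = "SOME bs. distinct bs \<and> set bs = {B \<in> \<pi>. card B \<noteq> 1}"
  have "distinct ?cs \<and> set ?cs = {B \<in> \<pi>. card B \<noteq> 1}"
    by (rule someI[where x = bs]) (use assms in auto)
  then have "mset ?cs = mset bs"
    using assms by (simp add: set_eq_iff_mset_eq_distinct[symmetric])
  then show ?thesis
    unfolding partition_coeff_def by (simp only: web_coeff_mset[of ?cs bs])
qed

text \<open>An injective relabelling preserves block sizes and incidences, so the image under
  \<open>w\<close> of an enumeration of the blocks serves for the relabelled partition.\<close>

lemma partition_coeff_perm_image:
  assumes w: "inj w" and fin: "finite \<pi>"
  shows "partition_coeff (perm_image w S) (map w xs) (map w ys) (perm_image w \<pi>) =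
    partition_coeff S xs ys \<pi>"
proof -
  obtain bs where bs: "distinct bs" "set bs = {B \<in> \<pi>. card B \<noteq> 1}"
    using finite_distinct_list[of "{B \<in> \<pi>. card B \<noteq> 1}"] fin by auto
  have card_w: "card (w ` B) = card B" for B
    using w by (meson card_image inj_on_subset subset_UNIV)
  have inj_w: "inj ((`) w)"
    using w by (simp add: inj_on_image)
  have "distinct (map ((`) w) bs)"
    using bs(1) inj_w by (meson distinct_map inj_on_subset subset_UNIV)
  moreover have "set (map ((`) w) bs) = {B \<in> perm_image w \<pi>. card B \<noteq> 1}"
    using bs(2) card_w by (auto simp: perm_image_def)
  moreover have "{B \<in> perm_image w \<pi>. card B = 1} = perm_image w {B \<in> \<pi>. card B = 1}"
    using card_w by (auto simp: perm_image_def)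
  moreover have "perm_image w {B \<in> \<pi>. card B = 1} = perm_image w S \<longleftrightarrow> {B \<in> \<pi>. card B = 1} = S"
    unfolding perm_image_def using inj_w by (rule inj_image_eq_iff)
  moreover have "web_coeff (map w xs) (map w ys) (map ((`) w) bs) = web_coeff xs ys bs"
    using w by (simp add: web_coeff_def block_det_map_image)
  ultimately show ?thesis
    using partition_coeff_eq[OF bs] partition_coeff_eq by simp
qed

text \<open>Places the two changing blocks before a common tail, the shape needed for
  \<open>web_coeff_five_term\<close>.\<close>

lemma partition_coeff_Un_pair:
  assumes bs: "distinct bs" "set bs = {B \<in> R. card B \<noteq> 1}"
    and XY: "X \<notin> R" "Y \<notin> R" "X \<noteq> Y" "card X \<noteq> 1" "card Y \<noteq> 1"
  shows "partition_coeff S xs ys (R \<union> {X, Y}) =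
    (if {B \<in> R. card B = 1} = S then web_coeff xs ys (X # Y # bs) else 0)"
proof -
  have "distinct (X # Y # bs)" "set (X # Y # bs) = {B \<in> R \<union> {X, Y}. card B \<noteq> 1}"
    using assms by auto
  moreover have "{B \<in> R \<union> {X, Y}. card B = 1} = {B \<in> R. card B = 1}"
    using XY by auto
  ultimately show ?thesis
    by (simp only: partition_coeff_eq)
qed

text \<open>The sets \<open>A\<close> and \<open>C\<close> are blocks stripped of \<open>i\<close>
  or \<open>j\<close>, so \<open>card A > 1\<close> means a block of size greater than 2. If
  \<open>A\<close> or \<open>C\<close> is a singleton, its term is absent here and the matching web
  coefficient vanishes, so one five-term identity covers all four cases.\<close>

lemma partition_coeff_five_term:
  assumes xy: "set xs \<inter> set ys = {}" and "finite R" "finite A" "finite C"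
    and disj: "A \<inter> C = {}" "i \<notin> A" "i \<notin> C" "j \<notin> A" "j \<notin> C" "i \<noteq> j"
    and ne: "A \<noteq> {}" "C \<noteq> {}"
    and R: "\<And>D. D \<in> R \<Longrightarrow> D \<inter> (A \<union> C \<union> {i, j}) = {}"
  shows "partition_coeff S xs ys (R \<union> {A \<union> {i}, C \<union> {j}})
       + partition_coeff S xs ys (R \<union> {A \<union> {j}, C \<union> {i}})
       + partition_coeff S xs ys (R \<union> {A \<union> C, {i, j}})
       - (if card A > 1 then partition_coeff S xs ys (R \<union> {A, C \<union> {i, j}}) else 0)
       - (if card C > 1 then partition_coeff S xs ys (R \<union> {C, A \<union> {i, j}}) else 0) = 0"
proof -
  obtain bs where bs: "distinct bs" "set bs = {B \<in> R. card B \<noteq> 1}"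
    using finite_distinct_list[of "{B \<in> R. card B \<noteq> 1}"] \<open>finite R\<close> by auto
  have notin: "X \<notin> R" if "X \<noteq> {}" "X \<subseteq> A \<union> C \<union> {i, j}" for X
    using R[of X] that by blast
  have cA: "card A \<ge> 1" and cC: "card C \<ge> 1"
    using assms by (simp_all add: Suc_le_eq card_gt_0_iff)
  have cards: "card (A \<union> {i}) = Suc (card A)" "card (A \<union> {j}) = Suc (card A)"
    "card (C \<union> {i}) = Suc (card C)" "card (C \<union> {j}) = Suc (card C)"
    "card (A \<union> C) = card A + card C" "card {i, j} = 2"
    "card (A \<union> {i, j}) = card A + 2" "card (C \<union> {i, j}) = card C + 2"
    using assms by (auto simp: card_Un_disjoint)
  have notins: "A \<union> {i} \<notin> R" "A \<union> {j} \<notin> R" "C \<union> {i} \<notin> R" "C \<union> {j} \<notin> R" "A \<union> C \<notin> R"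
    "{i, j} \<notin> R" "A \<notin> R" "C \<notin> R" "A \<union> {i, j} \<notin> R" "C \<union> {i, j} \<notin> R"
    by (rule notin; use ne in blast)+
  have neqs: "A \<union> {i} \<noteq> C \<union> {j}" "A \<union> {j} \<noteq> C \<union> {i}" "A \<union> C \<noteq> {i, j}"
    "A \<noteq> C \<union> {i, j}" "C \<noteq> A \<union> {i, j}"
    using disj by blast+
  note pair = partition_coeff_Un_pair[OF bs]
  have A1: "web_coeff xs ys (A # X # bs) = 0" if "\<not> card A > 1" for X
  proof -
    have "card A = 1" using that cA by simp
    then show ?thesis using web_coeff_singleton[OF xy] by (metis card_1_singletonE)
  qed
  have C1: "web_coeff xs ys (C # X # bs) = 0" if "\<not> card C > 1" for X
  proof -
    have "card C = 1" using that cC by simp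
    then show ?thesis using web_coeff_singleton[OF xy] by (metis card_1_singletonE)
  qed
  \<comment> \<open>Every partition that occurs has the singletons of \<open>R\<close> and no
    others, so one test against \<open>S\<close> serves all terms.\<close>
  let ?f = "\<lambda>X Y. if {B \<in> R. card B = 1} = S then web_coeff xs ys (X # Y # bs) else 0"
  have "partition_coeff S xs ys (R \<union> {A \<union> {i}, C \<union> {j}}) = ?f (A \<union> {i}) (C \<union> {j})"
    by (rule pair[OF notins(1) notins(4) neqs(1)]) (use cards cA cC in linarith)+
  moreover have "partition_coeff S xs ys (R \<union> {A \<union> {j}, C \<union> {i}}) = ?f (A \<union> {j}) (C \<union> {i})"
    by (rule pair[OF notins(2) notins(3) neqs(2)]) (use cards cA cC in linarith)+
  moreover have "partition_coeff S xs ys (R \<union> {A \<union> C, {i, j}}) = ?f (A \<union> C) {i, j}"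
    by (rule pair[OF notins(5) notins(6) neqs(3)]) (use cards cA cC in linarith)+
  moreover have "(if card A > 1 then partition_coeff S xs ys (R \<union> {A, C \<union> {i, j}}) else 0)
      = ?f A (C \<union> {i, j})"
  proof (cases "card A > 1")
    case True
    have "partition_coeff S xs ys (R \<union> {A, C \<union> {i, j}}) = ?f A (C \<union> {i, j})"
      by (rule pair[OF notins(7) notins(10) neqs(4)]) (use cards cA cC True in linarith)+
    with True show ?thesis by simp
  qed (simp add: A1)
  moreover have "(if card C > 1 then partition_coeff S xs ys (R \<union> {C, A \<union> {i, j}}) else 0)
      = ?f C (A \<union> {i, j})"
  proof (cases "card C > 1")
    case True
    have "partition_coeff S xs ys (R \<union> {C, A \<union> {i, j}}) = ?f C (A \<union> {i, j})"
      by (rule pair[OF notins(8) notins(9) neqs(5)]) (use cards cA cC True in linarith)+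
    with True show ?thesis by simp
  qed (simp add: C1)
  moreover have "X \<union> {i} \<union> {j} = X \<union> {i, j}" "{i} \<union> {j} = {i, j}" for X
    by auto
  ultimately show ?thesis
    using web_coeff_five_term[OF xy disj, of bs] by simp
qed

section \<open>Noncrossing partitions and crossings of adjacent points\<close>

definition same_block :: "set_partition \<Rightarrow> nat \<Rightarrow> nat \<Rightarrow> bool" where
  "same_block \<pi> x y \<longleftrightarrow> (\<exists>B\<in>\<pi>. x \<in> B \<and> y \<in> B)"

lemma disjoint_block_unique:
  assumes "disjoint \<pi>" "B \<in> \<pi>" "C \<in> \<pi>" "x \<in> B" "x \<in> C"
  shows "B = C"
proof (rule ccontr)
  assume "B \<noteq> C"
  with assms(4,5) show False using disjointD[OF assms(1-3)] by blast
qed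

lemma same_block_trans:
  assumes "disjoint \<pi>" "same_block \<pi> x y" "same_block \<pi> y z"
  shows "same_block \<pi> x z"
proof -
  obtain B C where "B \<in> \<pi>" "x \<in> B" "y \<in> B" "C \<in> \<pi>" "y \<in> C" "z \<in> C"
    using assms(2,3) unfolding same_block_def by blast
  moreover from this have "B = C"
    by (intro disjoint_block_unique[OF assms(1)])
  ultimately show ?thesis
    unfolding same_block_def by blast
qed

lemma same_block_sym: "same_block \<pi> x y \<Longrightarrow> same_block \<pi> y x"
  by (auto simp: same_block_def)

text \<open>Blocks sharing a point coincide, so linking \<open>a\<close> with \<open>b\<close>
  already puts all four points in one block.\<close>

lemma noncrossing_iff_same_block:
  assumes d: "disjoint \<pi>"
  shows "noncrossing \<pi> \<longleftrightarrow> (\<forall>a b c d. a < b \<longrightarrow> b < c \<longrightarrow> c < d \<longrightarrow>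
    same_block \<pi> a c \<longrightarrow> same_block \<pi> b d \<longrightarrow> same_block \<pi> a b)" (is "_ \<longleftrightarrow> ?R")
proof
  assume nc: "noncrossing \<pi>"
  show ?R
  proof (intro allI impI)
    fix a b c d :: nat
    assume "a < b" "b < c" "c < d" "same_block \<pi> a c" "same_block \<pi> b d"
    then have "\<exists>D\<in>\<pi>. a \<in> D \<and> b \<in> D \<and> c \<in> D \<and> d \<in> D"
      using nc[unfolded noncrossing_def, rule_format, of a b c d]
      unfolding same_block_def by simp
    then show "same_block \<pi> a b" unfolding same_block_def by metis
  qed
next
  assume R: ?R
  show "noncrossing \<pi>"
    unfolding noncrossing_def
  proof (intro allI impI, elim conjE)
    fix a b c d :: nat assume o: "a < b" "b < c" "c < d"
      and ac: "\<exists>B\<in>\<pi>. a \<in> B \<and> c \<in> B" and bd: "\<exists>C\<in>\<pi>. b \<in> C \<and> d \<in> C"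
    have "same_block \<pi> a b"
      using R o ac bd unfolding same_block_def by simp
    then obtain D where D: "D \<in> \<pi>" "a \<in> D" "b \<in> D"
      unfolding same_block_def by blast
    have "B = D" if "B \<in> \<pi>" "x \<in> B" "x \<in> D" for B x
      using disjoint_block_unique[OF d that(1) D(1) that(2,3)] .
    then have "c \<in> D" "d \<in> D"
      using ac bd D by metis+
    with D show "\<exists>D\<in>\<pi>. a \<in> D \<and> b \<in> D \<and> c \<in> D \<and> d \<in> D"
      by auto
  qed
qed

text \<open>A monotone map keeps four points in weak order. If two neighbours are identified, the
  conclusion follows from the relation itself; otherwise it is the noncrossing property of
  \<open>\<pi>\<close>.\<close>

lemma noncrossing_mono_pullback:
  assumes d: "disjoint \<pi>" "disjoint \<mu>" and nc: "noncrossing \<pi>" and f: "mono f"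
    and eq: "\<And>x y. same_block \<mu> x y \<longleftrightarrow> same_block \<pi> (f x) (f y)"
  shows "noncrossing \<mu>"
  unfolding noncrossing_iff_same_block[OF d(2)]
proof (intro allI impI)
  fix a b c d :: nat
  assume o: "a < b" "b < c" "c < d" and ac: "same_block \<mu> a c" and bd: "same_block \<mu> b d"
  have le: "f a \<le> f b" "f b \<le> f c" "f c \<le> f d"
    using o f by (auto simp: mono_def)
  have AC: "same_block \<pi> (f a) (f c)" and BD: "same_block \<pi> (f b) (f d)"
    using ac bd eq by auto
  consider "f a = f b" | "f b = f c" | "f c = f d" | "f a < f b" "f b < f c" "f c < f d"
    using le by linarith
  then have "same_block \<pi> (f a) (f b)"
  proof cases
    case 1
    then show ?thesis using AC by (auto simp: same_block_def)
  next
    case 2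
    then show ?thesis using AC by simp
  next
    case 3
    then show ?thesis
      using AC BD same_block_sym same_block_trans[OF d(1)] by metis
  next
    case 4
    then show ?thesis
      using nc AC BD unfolding noncrossing_iff_same_block[OF d(1)] by blast
  qed
  then show "same_block \<mu> a b" using eq by simp
qed

lemma same_block_perm_image_transp:
  "same_block (perm_image (adj_transp i) \<pi>) x y \<longleftrightarrow>
   same_block \<pi> (adj_transp i x) (adj_transp i y)"
proof -
  have "x \<in> adj_transp i ` B \<longleftrightarrow> adj_transp i x \<in> B" for x B
    by (auto intro: image_eqI[where x = "adj_transp i x"])
  then show ?thesis by (auto simp: same_block_def perm_image_def)
qed

lemma disjoint_perm_image: "inj w \<Longrightarrow> disjoint \<pi> \<Longrightarrow> disjoint (perm_image w \<pi>)"
  unfolding perm_image_def by (rule disjoint_image) (auto intro: inj_on_subset)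

text \<open>A point in a singleton takes part in no crossing, and away from it the swap preserves
  order. Hence a swap that creates a crossing involves two blocks of size at least 2.\<close>

lemma noncrossing_swap_singleton:
  assumes d: "disjoint \<pi>" and nc: "noncrossing \<pi>" and sing: "{k} \<in> \<pi>" and k: "k = i \<or> k = i + 1"
  shows "noncrossing (perm_image (adj_transp i) \<pi>)"
proof -
  let ?s = "adj_transp i"
  have neq: "?s x \<noteq> k" if sb: "same_block \<pi> (?s x) (?s y)" and ne: "x \<noteq> y" for x y
  proof
    assume x: "?s x = k"
    obtain B where B: "B \<in> \<pi>" "?s x \<in> B" "?s y \<in> B"
      using sb unfolding same_block_def by blast
    have "B = {k}"
      using disjoint_block_unique[OF d B(1) sing B(2)] x by simp
    then have "?s y = ?s x"
      using B x by blast
    then have "y = x"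
      by (rule injD[OF inj_transpose])
    with ne show False by simp
  qed
  \<comment> \<open>Only the pair \<open>i\<close>, \<open>i + 1\<close> is reversed, and one of
    these two is sent to \<open>k\<close>.\<close>
  have mono: "?s x < ?s y" if "x < y" "?s x \<noteq> k" "?s y \<noteq> k" for x y
    using that k unfolding transpose_def by (elim disjE) (simp_all split: if_splits)
  have dm: "disjoint (perm_image ?s \<pi>)"
    by (rule disjoint_perm_image[OF _ d]) (rule inj_transpose)
  show ?thesis
    unfolding noncrossing_iff_same_block[OF dm]
      same_block_perm_image_transp
  proof (intro allI impI)
    fix a b c d assume o: "a < b" "b < c" "c < d"
      and ac: "same_block \<pi> (?s a) (?s c)" and bd: "same_block \<pi> (?s b) (?s d)"
    have "?s a \<noteq> k" "?s b \<noteq> k" "?s c \<noteq> k" "?s d \<noteq> k"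
      using neq[of a c] neq[of c a] neq[of b d] neq[of d b] ac bd o
        same_block_sym[OF ac] same_block_sym[OF bd] by auto
    then have "?s a < ?s b" "?s b < ?s c" "?s c < ?s d"
      using o mono by auto
    then show "same_block \<pi> (?s a) (?s b)"
      using nc ac bd unfolding noncrossing_iff_same_block[OF \<open>disjoint \<pi>\<close>] by blast
  qed
qed

lemma set_partitions_perm_image:
  assumes "w permutes {1..n}" "\<pi> \<in> set_partitions n"
  shows "perm_image w \<pi> \<in> set_partitions n"
proof -
  have "inj w" using assms(1) by (rule permutes_inj)
  moreover have "\<Union>(perm_image w \<pi>) = {1..n}"
    using assms permutes_image[OF assms(1)]
    by (simp add: perm_image_def set_partitions_def partition_on_def flip: image_Union)
  ultimately show ?thesis
    using assms(2) disjoint_perm_image[of w \<pi>]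
    by (auto simp: set_partitions_def partition_on_def perm_image_def)
qed

lemma finite_NC: "finite (NC n)"
proof -
  have "finite (set_partitions n)"
    unfolding set_partitions_def by (rule finitely_many_partition_on) simp
  then show ?thesis by (rule rev_finite_subset) (auto simp: NC_def)
qed

text \<open>The letters follow the swapped partition: there \<open>i\<close> joins \<open>A\<close>
  and \<open>i + 1\<close> joins \<open>C\<close>, so in \<open>\<pi>\<close> itself the points are
  attached the other way round.\<close>

lemma crossing_structure:
  assumes pi: "\<pi> \<in> NC n" and i: "i \<in> {1..<n}"
    and cr: "\<not> noncrossing (perm_image (adj_transp i) \<pi>)"
  obtains A C R where "\<pi> = R \<union> {A \<union> {i + 1}, C \<union> {i}}" "A \<inter> C = {}"
    "i \<notin> A" "i \<notin> C" "i + 1 \<notin> A" "i + 1 \<notin> C" "A \<noteq> {}" "C \<noteq> {}" "finite A" "finite C" "finite R"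
    "\<And>D. D \<in> R \<Longrightarrow> D \<inter> (A \<union> C \<union> {i, i + 1}) = {}"
proof -
  have part: "partition_on {1..n} \<pi>" and nc: "noncrossing \<pi>"
    using pi by (auto simp: NC_def set_partitions_def)
  note d = partition_onD2[OF part] and un = partition_onD1[OF part]
  have "i \<in> \<Union>\<pi>" "i + 1 \<in> \<Union>\<pi>" unfolding un[symmetric] using i by simp_all
  then obtain P where P: "P \<in> \<pi>" "i \<in> P" by blast
  from \<open>i + 1 \<in> \<Union>\<pi>\<close> obtain Q where Q: "Q \<in> \<pi>" "i + 1 \<in> Q" by blast
  have uniq: "B = B'" if "B \<in> \<pi>" "B' \<in> \<pi>" "x \<in> B" "x \<in> B'" for B B' x
    using disjoint_block_unique[OF d that] .
  \<comment> \<open>If \<open>i\<close> and \<open>i + 1\<close> shared a block, the swap would fix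
    \<open>\<pi>\<close>, which is noncrossing.\<close>
  have "P \<noteq> Q"
  proof
    assume "P = Q"
    have "adj_transp i ` B = B" if "B \<in> \<pi>" for B
    proof (cases "B = P")
      case True
      then show ?thesis using P Q \<open>P = Q\<close> by (auto simp: image_iff transpose_def)
    next
      case False
      then have "i \<notin> B" "i + 1 \<notin> B"
        using uniq[OF that P(1) _ P(2)] uniq[OF that Q(1) _ Q(2)] \<open>P = Q\<close> by auto
      then show ?thesis by (auto simp: image_iff transpose_def)
    qed
    then have "perm_image (adj_transp i) \<pi> = \<pi>" by (simp add: perm_image_def)
    then show False using cr nc by simp
  qed
  have "P \<noteq> {i}" "Q \<noteq> {i + 1}"
    using noncrossing_swap_singleton[OF d nc, of i i] noncrossing_swap_singleton[OF d nc, of "i + 1" i]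
      cr P(1) Q(1) by auto
  have finB: "finite B" if "B \<in> \<pi>" for B
    using un that by (metis Union_upper finite_atLeastAtMost finite_subset)
  show thesis
  proof (rule that[of "\<pi> - {P, Q}" "Q - {i + 1}" "P - {i}"])
    have "Q - {i + 1} \<union> {i + 1} = Q" "P - {i} \<union> {i} = P" using P Q by auto
    then show "\<pi> = \<pi> - {P, Q} \<union> {Q - {i + 1} \<union> {i + 1}, P - {i} \<union> {i}}"
      using P Q by auto
    have "P \<inter> Q = {}" by (rule disjointD[OF d P(1) Q(1) \<open>P \<noteq> Q\<close>])
    then show "(Q - {i + 1}) \<inter> (P - {i}) = {}" "i \<notin> Q - {i + 1}" "i + 1 \<notin> P - {i}"
      using P Q by blast+
    show "Q - {i + 1} \<noteq> {}" "P - {i} \<noteq> {}"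
      using P Q \<open>P \<noteq> {i}\<close> \<open>Q \<noteq> {i + 1}\<close> by blast+
    show "finite (\<pi> - {P, Q})" using finite_elements[OF _ part] by simp
    show "D \<inter> (Q - {i + 1} \<union> (P - {i}) \<union> {i, i + 1}) = {}" if "D \<in> \<pi> - {P, Q}" for D
    proof -
      have "D \<inter> P = {}" "D \<inter> Q = {}"
        using that disjointD[OF d _ P(1)] disjointD[OF d _ Q(1)] by auto
      then show ?thesis using P Q by blast
    qed
  qed (use finB P Q in auto)
qed


section \<open>The partitions occurring in the resolution of a crossing\<close>

lemma same_block_Un_pair:
  "same_block (R \<union> {X, Y}) x y \<longleftrightarrow> same_block R x y \<or> (x \<in> X \<and> y \<in> X) \<or> (x \<in> Y \<and> y \<in> Y)"
  by (auto simp: same_block_def)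

locale crossing_swap =
  fixes n i :: nat and \<pi> R :: set_partition and A C :: "nat set"
  assumes pi_NC: "\<pi> \<in> NC n"
    and pi_eq: "\<pi> = R \<union> {A \<union> {i + 1}, C \<union> {i}}"
    and AC: "A \<inter> C = {}" "i \<notin> A" "i \<notin> C" "i + 1 \<notin> A" "i + 1 \<notin> C" "A \<noteq> {}" "C \<noteq> {}"
    and fin: "finite A" "finite C" "finite R"
    and R_disj: "\<And>D. D \<in> R \<Longrightarrow> D \<inter> (A \<union> C \<union> {i, i + 1}) = {}"
begin

lemma pi_partition: "partition_on {1..n} \<pi>" and pi_noncrossing: "noncrossing \<pi>"
  using pi_NC by (auto simp: NC_def set_partitions_def)

lemmas pi_disjoint = partition_onD2[OF pi_partition]

lemma R_notin: "D \<in> R \<Longrightarrow> x \<in> D \<Longrightarrow> x \<notin> A \<and> x \<notin> C \<and> x \<noteq> i \<and> x \<noteq> i + 1"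
  using R_disj by blast

lemma same_block_R: "same_block R x y \<Longrightarrow>
    x \<notin> A \<and> x \<notin> C \<and> x \<noteq> i \<and> x \<noteq> i + 1 \<and> y \<notin> A \<and> y \<notin> C \<and> y \<noteq> i \<and> y \<noteq> i + 1"
proof -
  assume "same_block R x y"
  then obtain D where "D \<in> R" "x \<in> D" "y \<in> D" unfolding same_block_def by blast
  then show ?thesis using R_notin[of D x] R_notin[of D y] by simp
qed

lemma notin_R: "X \<subseteq> A \<union> C \<union> {i, i + 1} \<Longrightarrow> X \<noteq> {} \<Longrightarrow> X \<notin> R"
  using R_disj by blast

lemma perm_image_eq: "perm_image (adj_transp i) \<pi> = R \<union> {A \<union> {i}, C \<union> {i + 1}}"
proof -
  have fix_set: "adj_transp i ` D = D" if "i \<notin> D" "i + 1 \<notin> D" for D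
  proof -
    have "adj_transp i ` D = id ` D"
      by (rule image_cong) (use that in \<open>auto simp: transpose_def\<close>)
    then show ?thesis by simp
  qed
  have "(\<lambda>B. adj_transp i ` B) ` R = id ` R"
  proof (rule image_cong)
    fix D assume "D \<in> R"
    then show "adj_transp i ` D = id D"
      using fix_set[of D] R_notin[of D i] R_notin[of D "i + 1"] by (metis id_apply)
  qed simp
  then have "(\<lambda>B. adj_transp i ` B) ` R = R" by simp
  moreover have "adj_transp i ` A = A" "adj_transp i ` C = C"
    using fix_set AC by auto
  ultimately show ?thesis
    unfolding pi_eq perm_image_def by (simp add: image_Un)
qed

lemma block_of_eq:
  "block_of (R \<union> {A \<union> {i}, C \<union> {i + 1}}) i = A \<union> {i}"
  "block_of (R \<union> {A \<union> {i}, C \<union> {i + 1}}) (i + 1) = C \<union> {i + 1}"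
  unfolding block_of_def
proof -
  show "(THE B. B \<in> R \<union> {A \<union> {i}, C \<union> {i + 1}} \<and> i \<in> B) = A \<union> {i}"
    by (rule the_equality) (use AC R_notin[of _ i] in auto)
  show "(THE B. B \<in> R \<union> {A \<union> {i}, C \<union> {i + 1}} \<and> i + 1 \<in> B) = C \<union> {i + 1}"
    by (rule the_equality) (use AC R_notin[of _ "i + 1"] in auto)
qed

lemma replace_blocks_eq:
  "replace_blocks i (R \<union> {A \<union> {i}, C \<union> {i + 1}}) X Y = R \<union> {X, Y}"
proof -
  have "A \<union> {i} \<notin> R" "C \<union> {i + 1} \<notin> R"
    by (rule notin_R; blast)+
  then show ?thesis
    unfolding replace_blocks_def block_of_eq by blast
qed

text \<open>The first term exchanges \<open>i\<close> and \<open>i + 1\<close> back and is therefore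
  \<open>\<pi>\<close> itself. The size conditions drop by one because \<open>A\<close> and
  \<open>C\<close> omit the swapped points.\<close>

lemma skein_resolution_eq:
  "skein_resolution i (perm_image (adj_transp i) \<pi>) =
     basis_vec \<pi> + basis_vec (R \<union> {A \<union> C, {i, i + 1}})
     - (if card A > 1 then basis_vec (R \<union> {A, C \<union> {i, i + 1}}) else 0)
     - (if card C > 1 then basis_vec (R \<union> {C, A \<union> {i, i + 1}}) else 0)"
proof -
  have sets: "A \<union> {i} - {i} = A" "C \<union> {i + 1} - {i + 1} = C"
    "A \<union> {i} \<union> (C \<union> {i + 1}) - {i, i + 1} = A \<union> C"
    "C \<union> {i + 1} \<union> {i} = C \<union> {i, i + 1}" "A \<union> {i} \<union> {i + 1} = A \<union> {i, i + 1}"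
    using AC by blast+
  have cards: "card (A \<union> {i}) = Suc (card A)" "card (C \<union> {i + 1}) = Suc (card C)"
    using AC fin by auto
  have "(2 < Suc k) = (1 < k)" for k :: nat by auto
  then show ?thesis
    unfolding skein_resolution_def Let_def perm_image_eq block_of_eq replace_blocks_eq sets cards
    by (simp only: pi_eq)
qed

lemma set_partitions_Un_pair:
  assumes "X \<union> Y = A \<union> C \<union> {i, i + 1}" "X \<inter> Y = {}" "X \<noteq> {}" "Y \<noteq> {}"
  shows "R \<union> {X, Y} \<in> set_partitions n"
proof -
  have "\<Union>\<pi> = \<Union>R \<union> (X \<union> Y)"
    unfolding assms(1) pi_eq by auto
  then have "\<Union>(R \<union> {X, Y}) = {1..n}"
    using partition_onD1[OF pi_partition] by auto
  moreover have "disjoint R" "{} \<notin> R"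
    using pi_disjoint partition_onD3[OF pi_partition] unfolding pi_eq
    by (auto intro: pairwise_subset)
  moreover have "D \<inter> X = {} \<and> D \<inter> Y = {}" if "D \<in> R" for D
    using R_disj[OF that] unfolding assms(1)[symmetric] by blast
  ultimately show ?thesis
    using assms(2-4) unfolding set_partitions_def partition_on_def
    by (auto simp: pairwise_insert disjnt_def Int_commute)
qed

text \<open>
  Splitting off \<open>A\<close> is the pull-back of \<open>\<pi>\<close> along the monotone map that moves \<open>i + 1\<close> onto \<open>i\<close>.
\<close>

lemma split_right_NC: "R \<union> {A, C \<union> {i, i + 1}} \<in> NC n"
proof -
  let ?f = "\<lambda>x. if x = i + 1 then i else x"
  have part: "R \<union> {A, C \<union> {i, i + 1}} \<in> set_partitions n"
    using AC by (intro set_partitions_Un_pair) auto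
  then have d: "disjoint (R \<union> {A, C \<union> {i, i + 1}})"
    by (simp add: set_partitions_def partition_on_def)
  have R: "same_block R (?f x) (?f y) \<longleftrightarrow> same_block R x y" for x y
    using same_block_R[of x y] same_block_R[of "?f x" "?f y"] by (auto split: if_splits)
  have "noncrossing (R \<union> {A, C \<union> {i, i + 1}})"
  proof (rule noncrossing_mono_pullback[OF pi_disjoint d pi_noncrossing])
    show "mono ?f" by (auto simp: mono_def)
    show "same_block (R \<union> {A, C \<union> {i, i + 1}}) x y \<longleftrightarrow> same_block \<pi> (?f x) (?f y)" for x y
      unfolding pi_eq same_block_Un_pair R using AC by auto
  qed
  with part show ?thesis by (simp add: NC_def)
qed

text \<open>Mirror image of \<open>split_right_NC\<close>: here \<open>i\<close> is moved onto
  \<open>i + 1\<close>, which lies with \<open>A\<close> in \<open>\<pi>\<close>.\<close>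

lemma split_left_NC: "R \<union> {C, A \<union> {i, i + 1}} \<in> NC n"
proof -
  let ?f = "\<lambda>x. if x = i then i + 1 else x"
  have part: "R \<union> {C, A \<union> {i, i + 1}} \<in> set_partitions n"
    using AC by (intro set_partitions_Un_pair) auto
  then have d: "disjoint (R \<union> {C, A \<union> {i, i + 1}})"
    by (simp add: set_partitions_def partition_on_def)
  have R: "same_block R (?f x) (?f y) \<longleftrightarrow> same_block R x y" for x y
    using same_block_R[of x y] same_block_R[of "?f x" "?f y"] by (auto split: if_splits)
  have "noncrossing (R \<union> {C, A \<union> {i, i + 1}})"
  proof (rule noncrossing_mono_pullback[OF pi_disjoint d pi_noncrossing])
    show "mono ?f" by (auto simp: mono_def)
    show "same_block (R \<union> {C, A \<union> {i, i + 1}}) x y \<longleftrightarrow> same_block \<pi> (?f x) (?f y)" for x y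
      unfolding pi_eq same_block_Un_pair R using AC by auto
  qed
  with part show ?thesis by (simp add: NC_def)
qed

text \<open>A point of \<open>P\<close> outside the interval would interlace with \<open>u\<close>,
  \<open>x\<close>, \<open>v\<close>, and noncrossingness would identify \<open>P\<close> with the
  different block \<open>D\<close>.\<close>

lemma block_stays_inside:
  assumes D: "D \<in> R" "u \<in> D" "v \<in> D" and P: "P = A \<union> {i + 1} \<or> P = C \<union> {i}"
    and xy: "x \<in> P" "y \<in> P" "u < x" "x < v"
  shows "u < y \<and> y < v"
proof (rule ccontr)
  have "P \<in> \<pi>" "D \<in> \<pi>" using P D by (auto simp: pi_eq)
  have apart: "\<not> same_block \<pi> z w" if "z \<in> P" "w \<in> D" for z w
    using that P R_notin[OF D(1) that(2)] same_block_R[of z w] AC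
    unfolding pi_eq same_block_Un_pair by auto
  have same: "same_block \<pi> u v" "same_block \<pi> x y"
    using D xy \<open>P \<in> \<pi>\<close> \<open>D \<in> \<pi>\<close> by (auto simp: same_block_def)
  note nc = pi_noncrossing[unfolded noncrossing_iff_same_block[OF pi_disjoint], rule_format]
  assume "\<not> (u < y \<and> y < v)"
  moreover have "y \<noteq> u" "y \<noteq> v"
    using apart[OF xy(2) D(2)] apart[OF xy(2) D(3)] xy(2) \<open>P \<in> \<pi>\<close> by (auto simp: same_block_def)
  ultimately consider "y < u" | "v < y" by linarith
  then show False
  proof cases
    case 1
    then have "same_block \<pi> y u"
      using nc[of y u x v] xy same same_block_sym by blast
    then show False using apart xy D by blast
  next
    case 2
    then have "same_block \<pi> u x"
      using nc[of u x v y] xy same by blast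
    then show False using apart xy D same_block_sym by blast
  qed
qed

text \<open>In \<open>\<pi>\<close> the set \<open>A\<close> is tied to \<open>i + 1\<close> and
  \<open>C\<close> to \<open>i\<close>. From \<open>x\<close> one passes to its anchor, then to the
  other anchor if necessary, then to \<open>y\<close>, never leaving the interval.\<close>

lemma merged_block_stays_inside:
  assumes D: "D \<in> R" "u \<in> D" "v \<in> D" and xy: "x \<in> A \<union> C" "y \<in> A \<union> C" "u < x" "x < v"
  shows "u < y \<and> y < v"
proof -
  have A: "u < y' \<and> y' < v" if "x' \<in> A \<union> {i + 1}" "y' \<in> A \<union> {i + 1}" "u < x'" "x' < v" for x' y'
    using block_stays_inside[OF D _ that] by blast
  have C: "u < y' \<and> y' < v" if "x' \<in> C \<union> {i}" "y' \<in> C \<union> {i}" "u < x'" "x' < v" for x' y'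
    using block_stays_inside[OF D _ that] by blast
  have ne: "u \<noteq> i" "u \<noteq> i + 1" "v \<noteq> i" "v \<noteq> i + 1"
    using R_notin[OF D(1)] D by auto
  \<comment> \<open>No integer lies strictly between the anchors, and \<open>u\<close>,
    \<open>v\<close> are neither of them, so the anchors are inside the interval together.\<close>
  have both: "(u < i \<and> i < v) \<longleftrightarrow> (u < i + 1 \<and> i + 1 < v)"
    using ne by linarith
  have "u < i \<and> i < v"
    using xy A[of x "i + 1"] C[of x i] both by auto
  then show ?thesis
    using xy(2) A[of "i + 1" y] C[of i y] both by auto
qed

lemma merge_NC: "R \<union> {A \<union> C, {i, i + 1}} \<in> NC n"
proof -
  let ?m = "R \<union> {A \<union> C, {i, i + 1}}"
  have part: "?m \<in> set_partitions n"
    using AC by (intro set_partitions_Un_pair) auto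
  then have d: "disjoint ?m"
    by (simp add: set_partitions_def partition_on_def)
  have nc: "same_block ?m a b" if o: "a < b" "b < c" "c < d"
    and ac: "same_block ?m a c" and bd: "same_block ?m b d" for a b c d
  proof -
    \<comment> \<open>A pair from \<open>{i, i + 1}\<close> has nothing strictly between its points;
      an interlacing of \<open>D\<close> with the merged block contradicts
      \<open>merged_block_stays_inside\<close>; two pairs from \<open>R\<close> are already governed
      by \<open>\<pi>\<close>.\<close>
    consider "a \<in> {i, i + 1}" "c \<in> {i, i + 1}" | "b \<in> {i, i + 1}" "d \<in> {i, i + 1}"
      | "{a, b, c, d} \<subseteq> A \<union> C"
      | D where "D \<in> R" "a \<in> D" "c \<in> D" "b \<in> A \<union> C" "d \<in> A \<union> C"
      | D where "D \<in> R" "b \<in> D" "d \<in> D" "a \<in> A \<union> C" "c \<in> A \<union> C"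
      | "same_block R a c" "same_block R b d"
      using ac bd unfolding same_block_Un_pair by (auto simp: same_block_def)
    then show ?thesis
    proof cases
      case 1
      then show ?thesis using o by auto
    next
      case 2
      then show ?thesis using o by auto
    next
      case 3
      then show ?thesis unfolding same_block_Un_pair by simp
    next
      case 4
      then show ?thesis
        using merged_block_stays_inside[of D a c b d] o by auto
    next
      case 5
      then show ?thesis
        using merged_block_stays_inside[of D b d c a] o by auto
    next
      case 6
      then have "same_block \<pi> a c" "same_block \<pi> b d"
        by (auto simp: pi_eq same_block_def)
      then have "same_block \<pi> a b"
        using pi_noncrossing o unfolding noncrossing_iff_same_block[OF pi_disjoint] by blast
      then have "same_block R a b"
        using same_block_R[OF 6(1)] unfolding pi_eq same_block_Un_pair by auto
      then show ?thesis unfolding same_block_Un_pair by simp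
    qed
  qed
  have "noncrossing ?m"
  proof (rule iffD2[OF noncrossing_iff_same_block[OF d]], intro allI impI)
    fix a b c d :: nat
    assume "a < b" "b < c" "c < d" "same_block ?m a c" "same_block ?m b d"
    then show "same_block ?m a b" by (rule nc)
  qed
  with part show ?thesis by (simp add: NC_def)
qed

end

section \<open>Separating noncrossing partitions\<close>

lemma NC_blockD:
  assumes "\<pi> \<in> NC n" "B \<in> \<pi>"
  shows "finite B" "B \<noteq> {}" "B \<subseteq> {1..n}"
proof -
  have p: "partition_on {1..n} \<pi>"
    using assms(1) by (simp add: NC_def set_partitions_def)
  show "B \<subseteq> {1..n}"
    using partition_onD1[OF p] assms(2) by auto
  then show "finite B" by (rule finite_subset) simp
  show "B \<noteq> {}"
    using partition_onD3[OF p] assms(2) by auto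
qed

lemma NC_disjoint: "\<pi> \<in> NC n \<Longrightarrow> disjoint \<pi>"
  unfolding NC_def set_partitions_def partition_on_def by blast

lemma NC_finite: "\<pi> \<in> NC n \<Longrightarrow> finite \<pi>"
  unfolding NC_def set_partitions_def by (auto intro: finite_elements)

lemma NC_Union: "\<pi> \<in> NC n \<Longrightarrow> \<Union>\<pi> = {1..n}"
  unfolding NC_def set_partitions_def partition_on_def by blast

text \<open>
  The block minima and maxima determine a noncrossing partition: a point lies in the innermost block
  that is open at that point. The induction over points needs that the two partitions
  already agree to the left of \<open>x\<close>.
\<close>

lemma Min_block_not_less:
  assumes pi: "\<pi> \<in> NC n" "\<pi>' \<in> NC n"
    and mins: "Min ` \<pi> = Min ` \<pi>'" and maxs: "Max ` \<pi> = Max ` \<pi>'"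
    and B: "B \<in> \<pi>" "x \<in> B" and B': "B' \<in> \<pi>'" "x \<in> B'"
    and below: "\<And>y E F. y < x \<Longrightarrow> E \<in> \<pi> \<Longrightarrow> F \<in> \<pi>' \<Longrightarrow> y \<in> E \<Longrightarrow> y \<in> F \<Longrightarrow> Min E = Min F"
  shows "\<not> Min B < Min B'"
proof
  assume less: "Min B < Min B'"
  note uniq = disjoint_block_unique[OF NC_disjoint[OF pi(1)]]
  note uniq' = disjoint_block_unique[OF NC_disjoint[OF pi(2)]]
  have Min_in: "Min E \<in> E \<and> Max E \<in> E" if "E \<in> \<pi> \<or> E \<in> \<pi>'" for E
    using that NC_blockD pi by (metis Max_in Min_in)
  \<comment> \<open>The block \<open>E\<close> of \<open>\<pi>\<close> opens where \<open>B'\<close>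
    does, and \<open>F\<close> below is the block of \<open>\<pi>'\<close> that closes where
    \<open>E\<close> does.\<close>
  obtain E where E: "E \<in> \<pi>" "Min E = Min B'"
    using mins B'(1) by (metis image_iff)
  then have "Max E \<in> Max ` \<pi>'"
    using maxs by blast
  then obtain F where F: "F \<in> \<pi>'" "Max F = Max E"
    by auto
  have "E \<noteq> B" using less E by auto
  then have x_notin: "x \<notin> E" using uniq[OF E(1) B(1) _ B(2)] by blast
  have "Min B' \<in> E" using Min_in[of E] E by simp
  have "Min B' \<noteq> x" using \<open>Min B' \<in> E\<close> x_notin by blast
  moreover have "Min B' \<le> x"
    using B' NC_blockD(1)[OF pi(2) B'(1)] by simp
  ultimately have "Min B' < x" by simp
  \<comment> \<open>Otherwise \<open>Min B < Min E < x < Max E\<close> would be a crossing of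
    \<open>B\<close> and \<open>E\<close>.\<close>
  have "Max E < x"
  proof (rule ccontr)
    assume "\<not> Max E < x"
    moreover have "Max E \<noteq> x" using Min_in[of E] E(1) x_notin by metis
    ultimately have "x < Max E" by simp
    moreover have "same_block \<pi> (Min B) x" "same_block \<pi> (Min B') (Max E)"
      using Min_in[of B] Min_in[of E] B E \<open>Min B' \<in> E\<close> by (auto simp: same_block_def)
    moreover have "noncrossing \<pi>" using pi(1) by (simp add: NC_def)
    ultimately have "same_block \<pi> (Min B) (Min B')"
      using less \<open>Min B' < x\<close> noncrossing_iff_same_block[OF NC_disjoint[OF pi(1)]] by blast
    then obtain D where "D \<in> \<pi>" "Min B \<in> D" "Min B' \<in> D" unfolding same_block_def by blast
    then have "D = B" "D = E"
      using uniq[of D B "Min B"] uniq[of D E "Min B'"] B(1) E(1) Min_in[of B] \<open>Min B' \<in> E\<close> by auto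
    then show False using \<open>E \<noteq> B\<close> by simp
  qed
  moreover have "Max E \<in> E" "Max E \<in> F"
    using Min_in[of E] Min_in[of F] E(1) F by auto
  \<comment> \<open>Agreement at \<open>Max E\<close>, left of \<open>x\<close>, identifies
    \<open>F\<close> with \<open>B'\<close>. But \<open>B'\<close> contains \<open>x\<close>, which
    lies beyond \<open>Max F = Max E\<close>.\<close>
  ultimately have "Min F = Min B'"
    using below[OF _ E(1) F(1)] E(2) by simp
  then have "F = B'"
    using uniq'[OF F(1) B'(1)] Min_in[of F] Min_in[of B'] F(1) B'(1) by metis
  then have "x \<le> Max E"
    using B'(2) F NC_blockD(1)[OF pi(2) F(1)] by (metis Max_ge)
  with \<open>Max E < x\<close> show False by simp
qed

lemma NC_eqI_Min_Max:
  assumes pi: "\<pi> \<in> NC n" "\<pi>' \<in> NC n"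
    and mins: "Min ` \<pi> = Min ` \<pi>'" and maxs: "Max ` \<pi> = Max ` \<pi>'"
  shows "\<pi> = \<pi>'"
proof -
  \<comment> \<open>Strong induction on the point, with \<open>Min_block_not_less\<close> applied in
    both directions.\<close>
  have eq: "Min B = Min B'" if "B \<in> \<pi>" "B' \<in> \<pi>'" "x \<in> B" "x \<in> B'" for x B B'
    using that
  proof (induction x arbitrary: B B' rule: less_induct)
    case (less x)
    have "\<not> Min B < Min B'"
      using Min_block_not_less[OF pi mins maxs] less by blast
    moreover have "\<not> Min B' < Min B"
      using Min_block_not_less[OF pi(2,1) mins[symmetric] maxs[symmetric]] less by metis
    ultimately show ?case by simp
  qed
  \<comment> \<open>Kept general so that symmetry yields both inclusions; within one partition a
    block is identified by its minimum.\<close>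
  have sub: "\<rho> \<subseteq> \<rho>'" if rho: "\<rho> \<in> NC n" "\<rho>' \<in> NC n"
    and eq: "\<And>x B B'. B \<in> \<rho> \<Longrightarrow> B' \<in> \<rho>' \<Longrightarrow> x \<in> B \<Longrightarrow> x \<in> B' \<Longrightarrow> Min B = Min B'" for \<rho> \<rho>'
  proof
    fix B assume B: "B \<in> \<rho>"
    have Min_in: "Min E \<in> E" if "E \<in> \<rho> \<or> E \<in> \<rho>'" for E
      using that NC_blockD rho by (metis Min_in)
    have "\<exists>B'\<in>\<rho>'. z \<in> B'" if "z \<in> E" "E \<in> \<rho>" for z E
      using NC_blockD(3)[OF rho(1) that(2)] NC_Union[OF rho(2)] that by blast
    then obtain B' where B': "B' \<in> \<rho>'" "Min B \<in> B'" using Min_in B by metis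
    have mm: "Min B = Min B'" using eq[OF B B'(1) _ B'(2)] Min_in B by blast
    have "B = B'"
    proof (rule set_eqI, rule iffI)
      fix y assume y: "y \<in> B"
      then obtain E where E: "E \<in> \<rho>'" "y \<in> E"
        using NC_blockD(3)[OF rho(1) B] NC_Union[OF rho(2)] by blast
      then have "Min E = Min B'" using eq[OF B E(1) y E(2)] mm by simp
      then have "E = B'"
        using disjoint_block_unique[OF NC_disjoint[OF rho(2)] E(1) B'(1), of "Min E"] Min_in E(1) B' by metis
      then show "y \<in> B'" using E by simp
    next
      fix y assume y: "y \<in> B'"
      then obtain E where E: "E \<in> \<rho>" "y \<in> E"
        using NC_blockD(3)[OF rho(2) B'(1)] NC_Union[OF rho(1)] by blast
      then have "Min E = Min B" using eq[OF E(1) B'(1) E(2) y] mm by simp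
      then have "E = B"
        using disjoint_block_unique[OF NC_disjoint[OF rho(1)] E(1) B, of "Min E"] Min_in E(1) B by metis
      then show "y \<in> B" using E by simp
    qed
    then show "B \<in> \<rho>'" using B' by simp
  qed
  have "\<pi> \<subseteq> \<pi>'"
    by (rule sub[OF pi]) (rule eq)
  moreover have "\<pi>' \<subseteq> \<pi>"
    by (rule sub[OF pi(2,1)]) (rule eq[symmetric])
  ultimately show ?thesis by simp
qed

text \<open>The order with respect to which the evaluation at minima and maxima is triangular.\<close>

definition total_span :: "set_partition \<Rightarrow> int" where
  "total_span \<pi> = (\<Sum>B \<in> {B \<in> \<pi>. card B \<noteq> 1}. int (Max B) - int (Min B))"

text \<open>A nonzero determinant matches each entry of \<open>xs\<close> with a block containing
  it, whose minimum is at most that entry. Equality of the sums forces equality in every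
  row.\<close>

lemma block_det_nonzero_Min:
  assumes nz: "block_det xs bs \<noteq> 0" and fin: "\<And>B. B \<in> set bs \<Longrightarrow> finite B"
  shows "(\<Sum>a<length bs. int (Min (bs ! a))) \<le> (\<Sum>a<length bs. int (xs ! a))"
    and "(\<Sum>a<length bs. int (xs ! a)) \<le> (\<Sum>a<length bs. int (Min (bs ! a)))
      \<Longrightarrow> Min ` set bs = (!) xs ` {..<length bs}"
proof -
  obtain p where p: "p permutes {..<length bs}" "\<And>a. a < length bs \<Longrightarrow> xs ! a \<in> bs ! p a"
    using block_det_nonzeroD[OF nz] by blast
  have lt: "p a < length bs" if "a < length bs" for a
    using p(1) that by (metis lessThan_iff permutes_in_image)
  have each: "int (Min (bs ! p a)) \<le> int (xs ! a)" if "a < length bs" for a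
    using fin lt[OF that] p(2)[OF that] by simp
  have reindex: "(\<Sum>a<length bs. int (Min (bs ! p a))) = (\<Sum>a<length bs. int (Min (bs ! a)))"
    using sum.permute[OF p(1), of "\<lambda>a. int (Min (bs ! a))"] by (simp add: o_def)
  have "(\<Sum>a<length bs. int (Min (bs ! p a))) \<le> (\<Sum>a<length bs. int (xs ! a))"
    using each by (intro sum_mono) simp
  with reindex show le: "(\<Sum>a<length bs. int (Min (bs ! a))) \<le> (\<Sum>a<length bs. int (xs ! a))" by simp
  assume "(\<Sum>a<length bs. int (xs ! a)) \<le> (\<Sum>a<length bs. int (Min (bs ! a)))"
  with le reindex have sums: "(\<Sum>a<length bs. (\<lambda>a. int (Min (bs ! p a))) a) = (\<Sum>a<length bs. (\<lambda>a. int (xs ! a)) a)"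
    by simp
  have eq: "Min (bs ! p a) = xs ! a" if "a < length bs" for a
    using sum_mono_inv[OF sums, of a] each that by simp
  have "Min ` set bs = (\<lambda>a. Min (bs ! a)) ` p ` {..<length bs}"
    unfolding permutes_image[OF p(1)] by (auto simp: set_conv_nth)
  also have "\<dots> = (!) xs ` {..<length bs}"
    unfolding image_image using eq by (intro image_cong) auto
  finally show "Min ` set bs = (!) xs ` {..<length bs}" .
qed

text \<open>The same matching argument with maxima and reversed inequalities.\<close>

lemma block_det_nonzero_Max:
  assumes nz: "block_det xs bs \<noteq> 0" and fin: "\<And>B. B \<in> set bs \<Longrightarrow> finite B"
  shows "(\<Sum>a<length bs. int (xs ! a)) \<le> (\<Sum>a<length bs. int (Max (bs ! a)))"
    and "(\<Sum>a<length bs. int (Max (bs ! a))) \<le> (\<Sum>a<length bs. int (xs ! a))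
      \<Longrightarrow> Max ` set bs = (!) xs ` {..<length bs}"
proof -
  obtain p where p: "p permutes {..<length bs}" "\<And>a. a < length bs \<Longrightarrow> xs ! a \<in> bs ! p a"
    using block_det_nonzeroD[OF nz] by blast
  have lt: "p a < length bs" if "a < length bs" for a
    using p(1) that by (metis lessThan_iff permutes_in_image)
  have each: "int (xs ! a) \<le> int (Max (bs ! p a))" if "a < length bs" for a
    using fin lt[OF that] p(2)[OF that] by simp
  have reindex: "(\<Sum>a<length bs. int (Max (bs ! p a))) = (\<Sum>a<length bs. int (Max (bs ! a)))"
    using sum.permute[OF p(1), of "\<lambda>a. int (Max (bs ! a))"] by (simp add: o_def)
  have "(\<Sum>a<length bs. int (xs ! a)) \<le> (\<Sum>a<length bs. int (Max (bs ! p a)))"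
    using each by (intro sum_mono) simp
  with reindex show le: "(\<Sum>a<length bs. int (xs ! a)) \<le> (\<Sum>a<length bs. int (Max (bs ! a)))" by simp
  assume "(\<Sum>a<length bs. int (Max (bs ! a))) \<le> (\<Sum>a<length bs. int (xs ! a))"
  with le reindex have sums: "(\<Sum>a<length bs. (\<lambda>a. int (xs ! a)) a) = (\<Sum>a<length bs. (\<lambda>a. int (Max (bs ! p a))) a)"
    by simp
  have eq: "Max (bs ! p a) = xs ! a" if "a < length bs" for a
    using sum_mono_inv[OF sums, of a] each that by simp
  have "Max ` set bs = (\<lambda>a. Max (bs ! a)) ` p ` {..<length bs}"
    unfolding permutes_image[OF p(1)] by (auto simp: set_conv_nth)
  also have "\<dots> = (!) xs ` {..<length bs}"
    unfolding image_image using eq by (intro image_cong) auto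
  finally show "Max ` set bs = (!) xs ` {..<length bs}" .
qed

lemma total_span_list:
  assumes "distinct bs" "set bs = {B \<in> \<pi>. card B \<noteq> 1}"
  shows "total_span \<pi> = (\<Sum>a<length bs. int (Max (bs ! a))) - (\<Sum>a<length bs. int (Min (bs ! a)))"
proof -
  have "total_span \<pi> = (\<Sum>B\<leftarrow>bs. int (Max B) - int (Min B))"
    unfolding total_span_def assms(2)[symmetric] by (rule sum.distinct_set_conv_list[OF assms(1)])
  also have "\<dots> = (\<Sum>a<length bs. int (Max (bs ! a)) - int (Min (bs ! a)))"
    by (simp add: sum_list_sum_nth atLeast0LessThan)
  finally show ?thesis by (simp add: sum_subtractf)
qed

text \<open>Triangularity: a nonzero value at \<open>\<pi>'\<close> forces its minima to sum to at
  most those of \<open>\<pi>\<close> and its maxima to at least those of \<open>\<pi>\<close>. The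
  bound on spans then makes both equalities, and minima and maxima determine the partition.\<close>

lemma partition_coeff_Min_Max:
  assumes pi: "\<pi> \<in> NC n" and bs: "distinct bs" "set bs = {B \<in> \<pi>. card B \<noteq> 1}"
  shows "set (map Min bs) \<inter> set (map Max bs) = {}"
    and "partition_coeff {B \<in> \<pi>. card B = 1} (map Min bs) (map Max bs) \<pi> = 1"
    and "\<And>\<pi>'. \<pi>' \<in> NC n \<Longrightarrow> total_span \<pi>' \<le> total_span \<pi> \<Longrightarrow>
      partition_coeff {B \<in> \<pi>. card B = 1} (map Min bs) (map Max bs) \<pi>' \<noteq> 0 \<Longrightarrow> \<pi>' = \<pi>"
proof -
  have Min_in: "Min B \<in> B \<and> Max B \<in> B" if "B \<in> set bs" for B
    using that bs NC_blockD[OF pi] by simp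
  show "set (map Min bs) \<inter> set (map Max bs) = {}"
  proof (rule ccontr)
    assume "set (map Min bs) \<inter> set (map Max bs) \<noteq> {}"
    \<comment> \<open>By disjointness a common value is both minimum and maximum of a single block,
      which would then be a singleton.\<close>
    then obtain B C where BC: "B \<in> set bs" "C \<in> set bs" "Min B = Max C" by auto
    then have "B \<in> \<pi>" "C \<in> \<pi>" using bs by auto
    then have "B = C"
      using disjoint_block_unique[OF NC_disjoint[OF pi], of B C "Min B"] Min_in BC by metis
    have "x = Min B" if "x \<in> B" for x
      using NC_blockD(1)[OF pi \<open>B \<in> \<pi>\<close>] that BC \<open>B = C\<close> by (metis Max_ge Min_le order_antisym)
    then have "B = {Min B}" using Min_in[OF BC(1)] by blast
    then have "card B = 1" by (metis card_1_singleton_iff One_nat_def)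
    then show False using BC(1) bs(2) by auto
  qed
  have disj: "disjoint (set bs)"
    using NC_disjoint[OF pi] bs(2) by (auto intro: pairwise_subset)
  have "block_det (map Min bs) bs = 1" "block_det (map Max bs) bs = 1"
    using Min_in by (auto intro!: block_det_representatives bs(1) disj)
  then show "partition_coeff {B \<in> \<pi>. card B = 1} (map Min bs) (map Max bs) \<pi> = 1"
    by (simp add: partition_coeff_eq[OF bs] web_coeff_def)
  fix \<pi>' assume pi': "\<pi>' \<in> NC n" and span: "total_span \<pi>' \<le> total_span \<pi>"
    and nz: "partition_coeff {B \<in> \<pi>. card B = 1} (map Min bs) (map Max bs) \<pi>' \<noteq> 0"
  obtain cs where cs: "distinct cs" "set cs = {B \<in> \<pi>'. card B \<noteq> 1}"
    using finite_distinct_list[of "{B \<in> \<pi>'. card B \<noteq> 1}"] NC_finite[OF pi'] by auto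
  from nz have sing: "{B \<in> \<pi>'. card B = 1} = {B \<in> \<pi>. card B = 1}"
    and "web_coeff (map Min bs) (map Max bs) cs \<noteq> 0"
    unfolding partition_coeff_eq[OF cs] by (auto split: if_splits)
  then have len: "length cs = length bs"
    and nzs: "block_det (map Min bs) cs \<noteq> 0" "block_det (map Max bs) cs \<noteq> 0"
    by (auto simp: web_coeff_def split: if_splits)
  have fin: "finite B" if "B \<in> set cs" for B
    using that cs(2) NC_blockD(1)[OF pi'] by auto
  let ?k = "length bs"
  have Min_sum: "(\<Sum>a<length cs. int (map Min bs ! a)) = (\<Sum>a<?k. int (Min (bs ! a)))"
    and Max_sum: "(\<Sum>a<length cs. int (map Max bs ! a)) = (\<Sum>a<?k. int (Max (bs ! a)))"
    using len by simp_all
  have sums: "(\<Sum>a<length cs. int (Min (cs ! a))) = (\<Sum>a<?k. int (Min (bs ! a)))"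
    "(\<Sum>a<length cs. int (Max (cs ! a))) = (\<Sum>a<?k. int (Max (bs ! a)))"
    using block_det_nonzero_Min(1)[OF nzs(1)] block_det_nonzero_Max(1)[OF nzs(2)] fin span
    unfolding total_span_list[OF bs] total_span_list[OF cs] Min_sum Max_sum by fastforce+
  have "Min ` set cs = (!) (map Min bs) ` {..<length cs}"
    by (rule block_det_nonzero_Min(2)[OF nzs(1) fin]) (simp_all only: Min_sum sums order_refl)
  also have "\<dots> = Min ` set bs"
    using len by (auto simp: set_conv_nth)
  finally have mins: "Min ` set cs = Min ` set bs" .
  have "Max ` set cs = (!) (map Max bs) ` {..<length cs}"
    by (rule block_det_nonzero_Max(2)[OF nzs(2) fin]) (simp_all only: Max_sum sums order_refl)
  also have "\<dots> = Max ` set bs"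
    using len by (auto simp: set_conv_nth)
  finally have maxs: "Max ` set cs = Max ` set bs" .
  \<comment> \<open>The singletons agree because both equal the prescribed set, so the equalities
    for the larger blocks extend to all blocks.\<close>
  have split: "\<rho> = {B \<in> \<rho>. card B = 1} \<union> {B \<in> \<rho>. card B \<noteq> 1}" for \<rho> :: set_partition
    by auto
  have "Min ` \<pi>' = Min ` \<pi>" "Max ` \<pi>' = Max ` \<pi>"
    using mins maxs unfolding bs(2) cs(2)
    by (subst (1 2) split, simp only: image_Un sing)+
  then show "\<pi>' = \<pi>"
    by (rule NC_eqI_Min_Max[OF pi' pi])
qed

text \<open>The linear functional with values \<open>partition_coeff\<close> on basis vectors.
  Summing over the fixed set \<open>NC n\<close> instead of the support makes linearity
  immediate.\<close>

definition pairing ::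
    "nat \<Rightarrow> set_partition \<Rightarrow> nat list \<Rightarrow> nat list \<Rightarrow> skein_vec \<Rightarrow> complex" where
  "pairing n S xs ys v = (\<Sum>\<pi>\<in>NC n. Poly_Mapping.lookup v \<pi> * partition_coeff S xs ys \<pi>)"

text \<open>At a support element of maximal span, the functional built from its own minima and
  maxima sees only that element, by triangularity.\<close>

lemma pairing_separates:
  assumes v: "Poly_Mapping.keys v \<subseteq> NC n"
    and zero: "\<And>S xs ys. set xs \<inter> set ys = {} \<Longrightarrow> pairing n S xs ys v = 0"
  shows "v = 0"
proof (rule ccontr)
  assume "v \<noteq> 0"
  then have keys: "finite (Poly_Mapping.keys v)" "Poly_Mapping.keys v \<noteq> {}" by auto
  then have "Max (total_span ` Poly_Mapping.keys v) \<in> total_span ` Poly_Mapping.keys v"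
    by (intro Max_in) auto
  then obtain \<pi> where \<pi>: "\<pi> \<in> Poly_Mapping.keys v"
    and "total_span \<pi> = Max (total_span ` Poly_Mapping.keys v)"
    by auto
  then have span: "total_span \<pi>' \<le> total_span \<pi>" if "\<pi>' \<in> Poly_Mapping.keys v" for \<pi>'
    using keys that by simp
  have pi: "\<pi> \<in> NC n" using \<pi> v by blast
  obtain bs where bs: "distinct bs" "set bs = {B \<in> \<pi>. card B \<noteq> 1}"
    using finite_distinct_list[of "{B \<in> \<pi>. card B \<noteq> 1}"] NC_finite[OF pi] by auto
  note mm = partition_coeff_Min_Max[OF pi bs]
  let ?c = "partition_coeff {B \<in> \<pi>. card B = 1} (map Min bs) (map Max bs)"
  have "0 = (\<Sum>\<pi>'\<in>NC n. Poly_Mapping.lookup v \<pi>' * ?c \<pi>')"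
    using zero[OF mm(1)] unfolding pairing_def by simp
  also have "\<dots> = (\<Sum>\<pi>'\<in>{\<pi>}. Poly_Mapping.lookup v \<pi>' * ?c \<pi>')"
  proof (rule sum.mono_neutral_right)
    show "\<forall>\<pi>'\<in>NC n - {\<pi>}. Poly_Mapping.lookup v \<pi>' * ?c \<pi>' = 0"
    proof
      fix \<pi>' assume "\<pi>' \<in> NC n - {\<pi>}"
      then show "Poly_Mapping.lookup v \<pi>' * ?c \<pi>' = 0"
        using mm(3)[of \<pi>'] span[of \<pi>'] by (auto simp: in_keys_iff)
    qed
  qed (use pi finite_NC in auto)
  also have "\<dots> = Poly_Mapping.lookup v \<pi>" using mm(2) by simp
  finally show False using \<pi> by (simp add: in_keys_iff)
qed

section \<open>The action of words\<close>

lemma lookup_scale_vec: "Poly_Mapping.lookup (scale_vec c v) \<rho> = c * Poly_Mapping.lookup v \<rho>"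
  by transfer (simp add: when_def)

lemma lookup_linear_extension:
  "Poly_Mapping.lookup (linear_extension f v) \<rho> =
     (\<Sum>\<pi>\<in>Poly_Mapping.keys v. Poly_Mapping.lookup v \<pi> * Poly_Mapping.lookup (f \<pi>) \<rho>)"
  by (simp add: linear_extension_def lookup_sum lookup_scale_vec)

section \<open>Linearity of the pairing\<close>

lemma pairing_add: "pairing n S xs ys (u + v) = pairing n S xs ys u + pairing n S xs ys v"
  by (simp add: pairing_def lookup_add distrib_right sum.distrib)

lemma pairing_diff: "pairing n S xs ys (u - v) = pairing n S xs ys u - pairing n S xs ys v"
  by (simp add: pairing_def lookup_minus left_diff_distrib sum_subtractf)

lemma pairing_uminus: "pairing n S xs ys (- v) = - pairing n S xs ys v"
  by (simp add: pairing_def sum_negf)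

lemma pairing_zero: "pairing n S xs ys 0 = 0"
  by (simp add: pairing_def)

lemma pairing_scale_vec: "pairing n S xs ys (scale_vec c v) = c * pairing n S xs ys v"
  by (simp add: pairing_def lookup_scale_vec sum_distrib_left mult.assoc)

lemma pairing_basis_vec:
  assumes "\<pi> \<in> NC n"
  shows "pairing n S xs ys (basis_vec \<pi>) = partition_coeff S xs ys \<pi>"
proof -
  have "pairing n S xs ys (basis_vec \<pi>) =
      (\<Sum>\<rho>\<in>NC n. if \<rho> = \<pi> then partition_coeff S xs ys \<rho> else 0)"
    unfolding pairing_def by (rule sum.cong) (auto simp: lookup_single when_def)
  then show ?thesis
    using assms finite_NC by simp
qed

lemma pairing_linear_extension:
  "pairing n S xs ys (linear_extension f v) =
     (\<Sum>\<pi>\<in>Poly_Mapping.keys v. Poly_Mapping.lookup v \<pi> * pairing n S xs ys (f \<pi>))"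
  unfolding pairing_def lookup_linear_extension sum_distrib_left sum_distrib_right mult.assoc
  by (rule sum.swap)

lemma keys_linear_extension:
  assumes "\<And>\<pi>. \<pi> \<in> Poly_Mapping.keys v \<Longrightarrow> Poly_Mapping.keys (f \<pi>) \<subseteq> X"
  shows "Poly_Mapping.keys (linear_extension f v) \<subseteq> X"
proof
  fix \<rho> assume "\<rho> \<in> Poly_Mapping.keys (linear_extension f v)"
  then have "(\<Sum>\<pi>\<in>Poly_Mapping.keys v. Poly_Mapping.lookup v \<pi> * Poly_Mapping.lookup (f \<pi>) \<rho>) \<noteq> 0"
    by (simp add: in_keys_iff lookup_linear_extension)
  then obtain \<pi> where "\<pi> \<in> Poly_Mapping.keys v" "Poly_Mapping.lookup (f \<pi>) \<rho> \<noteq> 0"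
    by (metis (no_types, lifting) mult_zero_right sum.neutral)
  then have "\<rho> \<in> Poly_Mapping.keys (f \<pi>)" "Poly_Mapping.keys (f \<pi>) \<subseteq> X"
    using assms by (simp_all add: in_keys_iff)
  then show "\<rho> \<in> X" by blast
qed

lemma adj_transp_permutes: "i \<in> {1..<n} \<Longrightarrow> adj_transp i permutes {1..n}"
  by (rule permutes_swap_id) auto

text \<open>The skein relation is built so that the swapped partition plus its resolution pairs to
  zero. Thus both branches of the generator have the same pairing: minus that of the relabelled
  partition.\<close>

lemma skein_gen_basis_cases:
  assumes pi: "\<pi> \<in> NC n" and i: "i \<in> {1..<n}"
  shows "Poly_Mapping.keys (skein_gen_basis i \<pi>) \<subseteq> NC n" (is ?keys)
    and "set xs \<inter> set ys = {} \<Longrightarrow>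
      pairing n (perm_image (adj_transp i) S) (map (adj_transp i) xs) (map (adj_transp i) ys)
        (skein_gen_basis i \<pi>) = - partition_coeff S xs ys \<pi>" (is "_ \<Longrightarrow> ?pair")
proof -
  let ?s = "adj_transp i"
  let ?\<mu> = "perm_image ?s \<pi>"
  let ?S = "perm_image ?s S" and ?xs = "map ?s xs" and ?ys = "map ?s ys"
  have swap: "partition_coeff ?S ?xs ?ys ?\<mu> = partition_coeff S xs ys \<pi>"
    by (rule partition_coeff_perm_image[OF inj_transpose NC_finite[OF pi]])
  have "?keys \<and> (set xs \<inter> set ys = {} \<longrightarrow> ?pair)"
  proof (cases "noncrossing ?\<mu>")
    case True
    then have mu: "?\<mu> \<in> NC n"
      using set_partitions_perm_image[OF adj_transp_permutes[OF i]] pi by (simp add: NC_def)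
    have "skein_gen_basis i \<pi> = - basis_vec ?\<mu>"
      using True by (simp add: skein_gen_basis_def Let_def)
    then show ?thesis
      using mu swap by (simp add: pairing_uminus pairing_basis_vec)
  next
    case False
    then have gen: "skein_gen_basis i \<pi> = skein_resolution i ?\<mu>"
      by (simp add: skein_gen_basis_def Let_def)
    obtain A C R where "\<pi> = R \<union> {A \<union> {i + 1}, C \<union> {i}}" "A \<inter> C = {}"
      "i \<notin> A" "i \<notin> C" "i + 1 \<notin> A" "i + 1 \<notin> C" "A \<noteq> {}" "C \<noteq> {}" "finite A" "finite C" "finite R"
      "\<And>D. D \<in> R \<Longrightarrow> D \<inter> (A \<union> C \<union> {i, i + 1}) = {}"
      using crossing_structure[OF pi i False] by metis
    then interpret crossing_swap n i \<pi> R A C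
      using pi by unfold_locales
    note ncs = pi_NC merge_NC split_right_NC split_left_NC
    have "Poly_Mapping.keys (skein_resolution i ?\<mu>) \<subseteq> NC n"
    proof
      fix \<rho> assume "\<rho> \<in> Poly_Mapping.keys (skein_resolution i ?\<mu>)"
      then have "\<rho> \<in> {\<pi>, R \<union> {A \<union> C, {i, i + 1}}, R \<union> {A, C \<union> {i, i + 1}}, R \<union> {C, A \<union> {i, i + 1}}}"
        unfolding skein_resolution_eq in_keys_iff
        by (auto simp: lookup_add lookup_minus lookup_single when_def split: if_splits)
      then show "\<rho> \<in> NC n"
        using ncs by (elim insertE) (simp_all only: empty_iff)
    qed
    moreover have ?pair if xy: "set xs \<inter> set ys = {}"
    proof -
      let ?c = "partition_coeff ?S ?xs ?ys"
      have "set ?xs \<inter> set ?ys = {}"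
        using xy by (auto dest!: injD[OF inj_transpose])
      \<comment> \<open>The first of the five terms is the crossing partition itself; the other four
        form its resolution.\<close>
      then have five: "?c ?\<mu> + ?c \<pi> + ?c (R \<union> {A \<union> C, {i, i + 1}})
         - (if card A > 1 then ?c (R \<union> {A, C \<union> {i, i + 1}}) else 0)
         - (if card C > 1 then ?c (R \<union> {C, A \<union> {i, i + 1}}) else 0) = 0"
        unfolding perm_image_eq unfolding pi_eq
        by (rule partition_coeff_five_term[OF _ fin(3,1,2) AC(1-5) _ AC(6,7) R_disj]) simp
      have "pairing n ?S ?xs ?ys (skein_resolution i ?\<mu>) =
          ?c \<pi> + ?c (R \<union> {A \<union> C, {i, i + 1}})
         - (if card A > 1 then ?c (R \<union> {A, C \<union> {i, i + 1}}) else 0)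
         - (if card C > 1 then ?c (R \<union> {C, A \<union> {i, i + 1}}) else 0)"
        unfolding skein_resolution_eq pairing_diff pairing_add if_distrib[of "pairing n ?S ?xs ?ys"]
          pairing_zero pairing_basis_vec[OF pi_NC] pairing_basis_vec[OF merge_NC]
          pairing_basis_vec[OF split_right_NC] pairing_basis_vec[OF split_left_NC] ..
      also have "\<dots> = - ?c ?\<mu>"
        using five by (simp add: algebra_simps eq_neg_iff_add_eq_0)
      finally show ?thesis unfolding gen swap .
    qed
    ultimately show ?thesis unfolding gen by blast
  qed
  then show ?keys "set xs \<inter> set ys = {} \<Longrightarrow> ?pair" by blast+
qed

lemma skein_gen_NC:
  assumes "Poly_Mapping.keys v \<subseteq> NC n" "i \<in> {1..<n}"
  shows "Poly_Mapping.keys (skein_gen i v) \<subseteq> NC n"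
  unfolding skein_gen_def
  by (rule keys_linear_extension) (use assms skein_gen_basis_cases(1) in blast)

lemma pairing_skein_gen:
  assumes v: "Poly_Mapping.keys v \<subseteq> NC n" and i: "i \<in> {1..<n}" and xy: "set xs \<inter> set ys = {}"
  shows "pairing n (perm_image (adj_transp i) S) (map (adj_transp i) xs) (map (adj_transp i) ys)
      (skein_gen i v) = - pairing n S xs ys v"
proof -
  have "pairing n (perm_image (adj_transp i) S) (map (adj_transp i) xs) (map (adj_transp i) ys)
      (skein_gen i v) =
      (\<Sum>\<pi>\<in>Poly_Mapping.keys v. Poly_Mapping.lookup v \<pi> * - partition_coeff S xs ys \<pi>)"
    unfolding skein_gen_def pairing_linear_extension
    by (rule sum.cong[OF refl], subst skein_gen_basis_cases(2)[OF _ i xy]) (use v in auto)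
  also have "\<dots> = (\<Sum>\<pi>\<in>NC n. Poly_Mapping.lookup v \<pi> * - partition_coeff S xs ys \<pi>)"
    using v by (intro sum.mono_neutral_left finite_NC) (auto simp: in_keys_iff)
  finally show ?thesis
    by (simp add: pairing_def sum_negf)
qed

section \<open>Words in adjacent transpositions\<close>

lemma perm_image_comp: "perm_image (f \<circ> g) \<pi> = perm_image f (perm_image g \<pi>)"
  by (auto simp: perm_image_def image_comp image_image)

lemma perm_image_id: "perm_image id \<pi> = \<pi>" "perm_image (\<lambda>x. x) \<pi> = \<pi>"
  by (simp_all add: perm_image_def)

lemma adj_word_Nil: "adj_word n [] w \<longleftrightarrow> w = id"
  by (auto simp: adj_word_def)

lemma adj_word_Cons:
  "adj_word n (i # is) w \<longleftrightarrow> i \<in> {1..<n} \<and> (\<exists>u. adj_word n is u \<and> w = adj_transp i \<circ> u)"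
  by (auto simp: adj_word_def)

lemma adj_word_permutes: "adj_word n is w \<Longrightarrow> w permutes {1..n}"
proof (induction "is" arbitrary: w)
  case Nil
  then have "w = id" by (simp only: adj_word_Nil)
  then show ?case by (simp only: permutes_id)
next
  case (Cons i "is")
  then obtain u where i: "i \<in> {1..<n}" and u: "u permutes {1..n}" "w = adj_transp i \<circ> u"
    by (auto simp: adj_word_Cons)
  show ?case
    unfolding u(2) by (rule permutes_compose[OF u(1) adj_transp_permutes[OF i]])
qed

text \<open>Each letter relabels the data \<open>S\<close>, \<open>xs\<close>, \<open>ys\<close> and
  contributes one factor -1, as does the sign of the transposition. The result depends on the word
  only through \<open>w\<close>.\<close>

lemma skein_word_pairing:
  assumes "adj_word n is w" "Poly_Mapping.keys v \<subseteq> NC n"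
  shows "Poly_Mapping.keys (foldr skein_gen is v) \<subseteq> NC n \<and>
    (\<forall>S xs ys. set xs \<inter> set ys = {} \<longrightarrow>
      pairing n (perm_image w S) (map w xs) (map w ys) (foldr skein_gen is v) =
      of_int (sign w) * pairing n S xs ys v)"
  using assms(1)
proof (induction "is" arbitrary: w)
  case Nil
  then have "w = id" by (simp only: adj_word_Nil)
  then show ?case
    using assms(2) by (simp add: perm_image_id)
next
  case (Cons i "is")
  then obtain u where i: "i \<in> {1..<n}" and u: "adj_word n is u" and w: "w = adj_transp i \<circ> u"
    by (auto simp: adj_word_Cons)
  note IH = Cons.IH[OF u]
  have perm: "u permutes {1..n}" by (rule adj_word_permutes[OF u])
  have "sign w = - sign u"
    unfolding w using perm
    by (subst sign_compose) (auto simp: sign_swap_id permutation_swap_id intro: permutes_imp_permutation[OF finite_atLeastAtMost])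
  moreover have "pairing n (perm_image w S) (map w xs) (map w ys) (foldr skein_gen (i # is) v) =
      - pairing n (perm_image u S) (map u xs) (map u ys) (foldr skein_gen is v)"
    if "set xs \<inter> set ys = {}" for S xs ys
  proof -
    have "set (map u xs) \<inter> set (map u ys) = {}"
      using that permutes_inj[OF perm] by (auto dest: injD)
    from pairing_skein_gen[OF conjunct1[OF IH] i this, of "perm_image u S"]
    show ?thesis by (simp add: w perm_image_comp)
  qed
  ultimately show ?case
    using IH skein_gen_NC[OF conjunct1[OF IH] i] by simp
qed

lemma adj_word_append:
  "adj_word n is u \<Longrightarrow> adj_word n js w \<Longrightarrow> adj_word n (is @ js) (u \<circ> w)"
proof (induction "is" arbitrary: u)
  case Nil
  then show ?case by (simp add: adj_word_Nil)
next
  case (Cons i "is")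
  then obtain u' where u': "i \<in> {1..<n}" "adj_word n is u'" "u = adj_transp i \<circ> u'"
    by (auto simp: adj_word_Cons)
  have "adj_word n (is @ js) (u' \<circ> w)"
    by (rule Cons.IH[OF u'(2) Cons.prems(2)])
  then show ?case
    using u'(1) unfolding append_Cons adj_word_Cons u'(3) comp_assoc by blast
qed

text \<open>Conjugation by the next adjacent transposition increases the distance of the two swapped
  points by one.\<close>

lemma adj_word_transpose:
  assumes "1 \<le> a"
  shows "a + Suc k \<le> n \<Longrightarrow> \<exists>is. adj_word n is (Transposition.transpose a (a + Suc k))"
proof (induction k)
  case 0
  then have "adj_word n [a] (Transposition.transpose a (a + Suc 0))"
    using assms by (auto simp: adj_word_def)
  then show ?case by blast
next
  case (Suc k)
  let ?b = "a + Suc k"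
  obtain "is" where "is": "adj_word n is (Transposition.transpose a ?b)"
    using Suc by auto
  have b: "adj_word n [?b] (adj_transp ?b)"
    using Suc.prems by (auto simp: adj_word_def)
  have "adj_transp ?b \<circ> Transposition.transpose a ?b \<circ> adj_transp ?b = Transposition.transpose a (a + Suc (Suc k))"
    by (auto simp: fun_eq_iff transpose_def)
  then show ?case
    using adj_word_append[OF adj_word_append[OF b "is"] b] by metis
qed

text \<open>Needed for uniqueness in \<open>skein_act\<close>: without any word for
  \<open>w\<close>, every vector would satisfy its defining condition.\<close>

lemma adj_word_exists:
  assumes "w permutes {1..n}"
  shows "\<exists>is. adj_word n is w"
  using assms finite_atLeastAtMost
proof (induction rule: permutes_induct)
  case id
  have "adj_word n [] id" by (simp add: adj_word_Nil)
  then show ?case by blast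
next
  case (swap a b p)
  have "\<exists>is. adj_word n is (Transposition.transpose a b)"
  proof (cases "a < b")
    case True
    then obtain k where "b = a + Suc k" using less_iff_Suc_add by auto
    then show ?thesis using swap adj_word_transpose[of a k n] by auto
  next
    case False
    then obtain k where "a = b + Suc k" using swap(3) less_iff_Suc_add by (metis linorder_neqE_nat add_Suc_right)
    then show ?thesis using swap adj_word_transpose[of b k n] by (auto simp: transpose_commute)
  qed
  then show ?case using swap adj_word_append by blast
qed

text \<open>Both sides are supported on \<open>NC n\<close> and have equal pairings, so they
  coincide. As the word is arbitrary, this also gives independence of the chosen expression.\<close>

lemma skein_word_basis_vec:
  assumes word: "adj_word n is w" and pi: "\<pi> \<in> NC n" and wpi: "perm_image w \<pi> \<in> NC n"
  shows "foldr skein_gen is (basis_vec \<pi>) =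
    scale_vec (of_int (sign w)) (basis_vec (perm_image w \<pi>))" (is "?u = ?v")
proof -
  have perm: "w permutes {1..n}" by (rule adj_word_permutes[OF word])
  have keys: "Poly_Mapping.keys (basis_vec \<pi>) \<subseteq> NC n" using pi by simp
  note W = skein_word_pairing[OF word keys]
  have "?u - ?v = 0"
  proof (rule pairing_separates)
    have "Poly_Mapping.keys ?v \<subseteq> NC n"
      using wpi by (auto simp: in_keys_iff lookup_scale_vec lookup_single when_def split: if_splits)
    then show "Poly_Mapping.keys (?u - ?v) \<subseteq> NC n"
      using W keys_diff[of ?u ?v] by blast
    fix S :: set_partition and xs ys :: "nat list" assume xy: "set xs \<inter> set ys = {}"
    \<comment> \<open>\<open>skein_word_pairing\<close> evaluates at data moved by \<open>w\<close>,
      so arbitrary test data are first pulled back along the inverse.\<close>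
    let ?w' = "inv w"
    let ?S = "perm_image ?w' S" and ?xs = "map ?w' xs" and ?ys = "map ?w' ys"
    have pull: "perm_image w ?S = S" "map w ?xs = xs" "map w ?ys = ys"
      using permutes_inv_o(1)[OF perm]
      by (simp_all add: perm_image_id flip: perm_image_comp)
    have "set ?xs \<inter> set ?ys = {}"
      using xy permutes_inj[OF permutes_inv[OF perm]] by (auto dest: injD)
    then have "pairing n S xs ys ?u = of_int (sign w) * partition_coeff ?S ?xs ?ys \<pi>"
      using W[THEN conjunct2, rule_format, of ?xs ?ys ?S] unfolding pull
      by (simp add: pairing_basis_vec[OF pi])
    also have "partition_coeff ?S ?xs ?ys \<pi> = partition_coeff S xs ys (perm_image w \<pi>)"
      using partition_coeff_perm_image[OF permutes_inj[OF perm] NC_finite[OF pi], of ?S ?xs ?ys]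
      unfolding pull by simp
    finally show "pairing n S xs ys (?u - ?v) = 0"
      unfolding pairing_diff pairing_scale_vec pairing_basis_vec[OF wpi] by simp
  qed
  then show ?thesis by simp
qed

theorem corollary6p8:
  fixes n :: nat and w :: "nat \<Rightarrow> nat" and \<pi> :: set_partition
  assumes "w permutes {1..n}"
    and "\<pi> \<in> NC n"
    and "perm_image w \<pi> \<in> NC n"
  shows "skein_act n w (basis_vec \<pi>) =
         scale_vec (of_int (sign w)) (basis_vec (perm_image w \<pi>))"
  unfolding skein_act_def
proof (rule the_equality)
  show "\<forall>is. adj_word n is w \<longrightarrow> foldr skein_gen is (basis_vec \<pi>) =
      scale_vec (of_int (sign w)) (basis_vec (perm_image w \<pi>))"
    using skein_word_basis_vec assms by blast
  \<comment> \<open>Evaluating the assumed common value at one existing word determines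
    \<open>u\<close>.\<close>
  then show "u = scale_vec (of_int (sign w)) (basis_vec (perm_image w \<pi>))"
    if "\<forall>is. adj_word n is w \<longrightarrow> foldr skein_gen is (basis_vec \<pi>) = u" for u
    using adj_word_exists[OF assms(1)] that by metis
qed

end
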